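(* Let $d\ge 2$, let $v_1,\ldots,v_d\in\mathbb{R}^d$ be linearly independent, let $\Sigma=\{x_1v_1+\cdots+x_dv_d:\ x_1,\ldots,x_d\ge 0\}$, and let $m\ge 2$. (i) For Lebesgue-a.e. $\mathcal{A}\in\mathcal{X}_{\Sigma,m}$, the $m$-tuple $\mathcal{A}$ is strongly Diophantine. In particular, Lebesgue-a.e. $m$-tuple of $GL_d(\mathbb{R})$ matrices with all entries positive is strongly Diophantine. (ii) For a.e. $\mathcal{A}\in\mathcal{Y}_{\Sigma,m}$ (with respect to the smooth measure on this $(d^2-1)m$-dimensional manifold), the $m$-tuple $\mathcal{A}$ is strongly Diophantine. In particular, a.e. $m$-tuple of $SL_d(\mathbb{R})$ matrices with all entries positive is strongly Diophantine.
   Context: A matrix $A\in GL_d(\mathbb{R})$ is said to strictly preserve (have strictly invariant) the cone $\Sigma$ if $A(\Sigma\setminus\{0\})\subset\Sigma^\circ$ (the interior of $\Sigma$). $\mathcal{X}_{\Sigma,m}$ denotes the set of $m$-tuples of $GL_d(\mathbb{R})$ matrices each of which strictly preserves $\Sigma$, viewed as an open subset of $\mathbb{R}^{d^2m}$; $\mathcal{Y}_{\Sigma,m}$ is the set of such $m$-tuples of $SL_d(\mathbb{R})$ matrices, viewed as a $(d^2-1)m$-dimensional manifold. For a finite family $\mathcal{A}=\{A_i\}_{i\in\Lambda}$ and a word $\mathbf{i}=i_1\ldots i_n\in\Lambda^n$, write $A_{\mathbf{i}}=A_{i_1}\cdots A_{i_n}$. The family is strongly Diophantine if there is $c>0$ such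 that for all $n\in\mathbb{N}$ and all $\mathbf{i}\ne\mathbf{j}$ in $\Lambda^n$, $\|A_{\mathbf{i}}-A_{\mathbf{j}}\|>c^n$ (operator norm). *)

theory Defs
  imports "HOL-Analysis.Analysis"
begin

text \<open>Tuples of m matrices in dimension d: elements of real^'n^'n^'m,
  with d = CARD('n), m = CARD('m); the i-th matrix of A is A$i.
  This type is a Euclidean space of dimension d^2 m, carrying Lebesgue measure.\<close>

type_synonym ('n,'m) mtuple = "real^'n^'n^'m"

definition cone_of :: "('n::finite \<Rightarrow> real^'n) \<Rightarrow> (real^'n) set" where
  "cone_of v = {(\<Sum>i\<in>UNIV. x i *\<^sub>R v i) | x. \<forall>i. x i \<ge> 0}"

definition strictly_preserves :: "real^'n^'n \<Rightarrow> (real^'n) set \<Rightarrow> bool" where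
  "strictly_preserves A S \<longleftrightarrow> (\<forall>x \<in> S - {0}. A *v x \<in> interior S)"

definition X_set :: "(real^'n) set \<Rightarrow> ('n::finite,'m::finite) mtuple set" where
  "X_set S = {A. \<forall>i. invertible (A$i) \<and> strictly_preserves (A$i) S}"

definition Y_set :: "(real^'n) set \<Rightarrow> ('n::finite,'m::finite) mtuple set" where
  "Y_set S = {A. \<forall>i. det (A$i) = 1 \<and> strictly_preserves (A$i) S}"

definition word_prod :: "('n::finite,'m::finite) mtuple \<Rightarrow> 'm list \<Rightarrow> real^'n^'n" where
  "word_prod A w = foldr (\<lambda>i M. A$i ** M) w (mat 1)"

definition strongly_diophantine :: "('n::finite,'m::finite) mtuple \<Rightarrow> bool" where
  "strongly_diophantine A \<longleftrightarrow> (\<exists>c>0. \<forall>n::nat. \<forall>w1 w2.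
      length w1 = n \<and> length w2 = n \<and> w1 \<noteq> w2 \<longrightarrow>
      onorm (\<lambda>x. (word_prod A w1 - word_prod A w2) *v x) > c ^ n)"

definition c1_immersion_on ::
  "'k::euclidean_space set \<Rightarrow> ('k \<Rightarrow> 'a::euclidean_space) \<Rightarrow> bool" where
  "c1_immersion_on U \<phi> \<longleftrightarrow> (\<exists>\<phi>'. continuous_on U \<phi>' \<and>
     (\<forall>u\<in>U. (\<phi> has_derivative blinfun_apply (\<phi>' u)) (at u) \<and> inj (blinfun_apply (\<phi>' u))))"

text \<open>N is a null set for the smooth measure class of a submanifold M whose
  dimension equals DIM('k): its preimage under every C^1 immersion of an open
  subset of 'k into M is Lebesgue-null (equivalently, under every chart).\<close>
definition smooth_null :: "'k::euclidean_space itself \<Rightarrow> 'a::euclidean_space set \<Rightarrow> 'a set \<Rightarrow> bool" where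
  "smooth_null _ M N \<longleftrightarrow> (\<forall>(U::'k set) \<phi>. open U \<and> c1_immersion_on U \<phi> \<and> \<phi> ` U \<subseteq> M
      \<longrightarrow> {u \<in> U. \<phi> u \<in> N} \<in> null_sets lebesgue)"

end

(*
  Change of basis turns the cone into the positive orthant, so consider tuples of positive matrices.
  Apply a word to the all-ones vector 1 and record the ratio of two fixed coordinates.  It suffices
  that for words w, w' of equal length n with different first letters these ratios differ by at
  least c^n ("head separation"); common prefixes cost only a factor exponential in n.

  On a line A + sD, where D consists of rank-one matrices with pairwise different image directions,
  the ratio differences extend holomorphically to a neighbourhood of a real segment that does not
  depend on the words, with a uniform bound, because slightly complexified positive matrices
  preserve a complex cone.  At a large s they are all bounded away from 0, the first letter being
  decisive there.  By Montel's theorem some derivative of bounded order is then uniformly nonzero at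
  any given point, so {s : |difference| < eta u^k} has measure O(u) with k independent of the words.
  Taking u = L^-n beats the exponential number of pairs of words, and L tending to infinity shows
  that almost every s is good.  Fubini gives the statement for GL.

  The bad set is invariant under scaling the matrices separately by positive factors, so for SL one
  multiplies the parameter space by the scaling factors and pulls a null set back along a map with
  injective derivative between spaces of equal dimension.
*)
theory Submission
  imports Defs "HOL-Complex_Analysis.Great_Picard"
begin

section \<open>Sublevel sets in normal families\<close>

text \<open>By induction on \<open>k\<close>. In the step, \<open>g k\<close> grows with slope at
  least \<open>\<eta>\<close>, so its absolute value is below \<open>\<eta> * u\<close> only on a
  set of diameter at most 2u, which one ball covers. To the right and to the left of that set the
  induction hypothesis applies to \<open>g\<close> and to its negative, with
  \<open>\<eta> * u\<close> in place of \<open>\<eta>\<close>.\<close>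

lemma sublevel_cover:
  fixes g :: "nat \<Rightarrow> real \<Rightarrow> real"
  assumes "is_interval J"
    and "\<And>i s. i < k \<Longrightarrow> s \<in> J \<Longrightarrow> (g i has_real_derivative g (Suc i) s) (at s)"
    and "\<And>s. s \<in> J \<Longrightarrow> \<eta> \<le> g k s"
    and "\<eta> > 0" "u > 0"
  shows "\<exists>F. finite F \<and> card F < 2 ^ k \<and> {s \<in> J. \<bar>g 0 s\<bar> < \<eta> * u ^ k} \<subseteq> (\<Union>c\<in>F. cball c (2 * u))"
  using assms
proof (induction k arbitrary: g J \<eta>)
  case 0
  have "{s \<in> J. \<bar>g 0 s\<bar> < \<eta> * u ^ 0} = {}"
    using "0.prems"(3) by (fastforce simp: not_less)
  then show ?case by (intro exI[of _ "{}"]) auto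
next
  case (Suc k)
  have slope: "\<eta> * (t - s) \<le> g k t - g k s" if "s \<in> J" "t \<in> J" "s \<le> t" for s t
  proof (cases "s = t")
    case False
    then have "s < t" using that by simp
    have sub: "{s..t} \<subseteq> J"
      using \<open>is_interval J\<close> that by (meson atLeastAtMost_iff mem_is_interval_1_I subsetI)
    obtain z where z: "s < z" "z < t" "g k t - g k s = (t - s) * g (Suc k) z"
      using MVT2[OF \<open>s < t\<close>, of "g k" "g (Suc k)"] Suc.prems(2)[of k] sub by force
    have "\<eta> \<le> g (Suc k) z" using z sub by (intro Suc.prems(3)) auto
    then show ?thesis using z \<open>s < t\<close> by (simp add: mult.commute)
  qed simp
  have mono: "g k s \<le> g k t" if "s \<in> J" "t \<in> J" "s \<le> t" for s t
    using slope[OF that] that \<open>\<eta> > 0\<close> by (smt (verit) mult_nonneg_nonneg)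
  define J1 J2 where "J1 = {s \<in> J. \<eta> * u \<le> g k s}" and "J2 = {s \<in> J. g k s \<le> - (\<eta> * u)}"
  have betw: "c \<in> J" if "a \<in> J" "b \<in> J" "a \<le> c" "c \<le> b" for a b c
    using \<open>is_interval J\<close> that by (meson mem_is_interval_1_I)
  have J1: "is_interval J1"
    unfolding is_interval_1
  proof (intro ballI allI impI)
    fix a b c assume *: "a \<in> J1" "b \<in> J1" "a \<le> c \<and> c \<le> b"
    then have "c \<in> J" using betw unfolding J1_def by blast
    then show "c \<in> J1" using * mono[of a c] unfolding J1_def by auto
  qed
  have J2: "is_interval J2"
    unfolding is_interval_1
  proof (intro ballI allI impI)
    fix a b c assume *: "a \<in> J2" "b \<in> J2" "a \<le> c \<and> c \<le> b"
    then have "c \<in> J" using betw unfolding J2_def by blast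
    then show "c \<in> J2" using * mono[of c b] unfolding J2_def by auto
  qed
  have "\<eta> * u > 0" using Suc.prems by simp
  obtain F1 where F1: "finite F1" "card F1 < 2 ^ k"
    "{s \<in> J1. \<bar>g 0 s\<bar> < (\<eta> * u) * u ^ k} \<subseteq> (\<Union>c\<in>F1. cball c (2 * u))"
  proof -
    have "\<exists>F. finite F \<and> card F < 2 ^ k \<and>
        {s \<in> J1. \<bar>g 0 s\<bar> < (\<eta> * u) * u ^ k} \<subseteq> (\<Union>c\<in>F. cball c (2 * u))"
      by (rule Suc.IH[OF J1]) (use Suc.prems(2,5) \<open>\<eta> * u > 0\<close> J1_def in simp_all)
    then show ?thesis using that by blast
  qed
  obtain F2 where F2: "finite F2" "card F2 < 2 ^ k"
    "{s \<in> J2. \<bar>- g 0 s\<bar> < (\<eta> * u) * u ^ k} \<subseteq> (\<Union>c\<in>F2. cball c (2 * u))"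
  proof -
    have "\<exists>F. finite F \<and> card F < 2 ^ k \<and>
        {s \<in> J2. \<bar>- g 0 s\<bar> < (\<eta> * u) * u ^ k} \<subseteq> (\<Union>c\<in>F. cball c (2 * u))"
      by (rule Suc.IH[OF J2, of "\<lambda>i s. - g i s"])
         (use Suc.prems(2,5) \<open>\<eta> * u > 0\<close> J2_def in \<open>auto intro!: DERIV_minus\<close>)
    then show ?thesis using that by blast
  qed
  define Z where "Z = {s \<in> J. \<bar>g k s\<bar> < \<eta> * u}"
  obtain F3 where F3: "finite F3" "card F3 \<le> 1" "Z \<subseteq> (\<Union>c\<in>F3. cball c (2 * u))"
  proof (cases "Z = {}")
    case False
    then obtain c where c: "c \<in> Z" by auto
    have "Z \<subseteq> cball c (2 * u)"
    proof
      fix s assume s: "s \<in> Z"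
      have "\<eta> * \<bar>s - c\<bar> \<le> \<bar>g k s - g k c\<bar>"
        using slope[of s c] slope[of c s] s c unfolding Z_def
        by (cases "s \<le> c") (auto simp: abs_if)
      also have "\<dots> \<le> \<eta> * (2 * u)" using s c unfolding Z_def by auto
      finally show "s \<in> cball c (2 * u)"
        using \<open>\<eta> > 0\<close> by (simp add: dist_real_def abs_minus_commute)
    qed
    then show ?thesis using that[of "{c}"] by auto
  qed (use that[of "{}"] in auto)
  have "card (F1 \<union> F2 \<union> F3) \<le> card F1 + card F2 + card F3"
    by (meson add_le_cancel_right card_Un_le order_trans)
  moreover have "{s \<in> J. \<bar>g 0 s\<bar> < \<eta> * u ^ Suc k} \<subseteq> (\<Union>c\<in>F1 \<union> F2 \<union> F3. cball c (2 * u))"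
  proof
    fix s assume s: "s \<in> {s \<in> J. \<bar>g 0 s\<bar> < \<eta> * u ^ Suc k}"
    then consider "s \<in> Z" | "s \<in> J1" | "s \<in> J2" unfolding Z_def J1_def J2_def by fastforce
    then show "s \<in> (\<Union>c\<in>F1 \<union> F2 \<union> F3. cball c (2 * u))"
    proof cases
      case 1
      then show ?thesis using F3(3) by blast
    next
      case 2
      then have "s \<in> {s \<in> J1. \<bar>g 0 s\<bar> < (\<eta> * u) * u ^ k}" using s by (simp add: mult_ac)
      then show ?thesis using F1(3) by blast
    next
      case 3
      then have "s \<in> {s \<in> J2. \<bar>- g 0 s\<bar> < (\<eta> * u) * u ^ k}" using s by (simp add: mult_ac)
      then show ?thesis using F2(3) by blast
    qed
  qed
  \<comment> \<open>The strictness of the count leaves room for the middle ball: twice at most 2^k -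
    1, plus one, is below 2^(k+1).\<close>
  moreover have "(2::nat) ^ Suc k = 2 ^ k + 2 ^ k" by simp
  then have "card F1 + card F2 + card F3 < 2 ^ Suc k" using F1(2) F2(2) F3(2) by linarith
  ultimately show ?case using F1(1) F2(1) F3(1)
    by (intro exI[of _ "F1 \<union> F2 \<union> F3"] conjI) (blast | linarith)+
qed

text \<open>By compactness. If no pair \<open>k\<close>, \<open>\<eta>\<close> worked, there would
  be functions in \<open>H\<close> whose derivatives at \<open>z0\<close> up to order n are all
  below 1/(n+1). A Montel limit of them has all derivatives zero at \<open>z0\<close>, hence
  vanishes on the connected \<open>\<Omega>\<close>, although its modulus at \<open>z1\<close> is at
  least \<open>\<delta>\<close>.\<close>

lemma normal_family_deriv_lower_bound:
  assumes \<Omega>: "open \<Omega>" "connected \<Omega>" and z: "z0 \<in> \<Omega>" "z1 \<in> \<Omega>" and "\<delta> > 0"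
    and hol: "\<And>h. h \<in> H \<Longrightarrow> h holomorphic_on \<Omega>"
    and bd: "\<And>h z. h \<in> H \<Longrightarrow> z \<in> \<Omega> \<Longrightarrow> norm (h z) \<le> M"
    and low: "\<And>h. h \<in> H \<Longrightarrow> \<delta> \<le> norm (h z1)"
  obtains k \<eta> where "\<eta> > 0" "\<And>h. h \<in> H \<Longrightarrow> \<exists>j\<le>k. \<eta> \<le> norm ((deriv ^^ j) h z0)"
proof -
  have "\<exists>k \<eta>. \<eta> > 0 \<and> (\<forall>h\<in>H. \<exists>j\<le>k. \<eta> \<le> norm ((deriv ^^ j) h z0))"
  proof (rule ccontr)
    assume contra: "\<not> ?thesis"
    have "\<exists>h\<in>H. \<forall>j\<le>n. norm ((deriv ^^ j) h z0) < 1 / Suc n" for n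
    proof -
      have "\<not> (\<forall>h\<in>H. \<exists>j\<le>n. 1 / Suc n \<le> norm ((deriv ^^ j) h z0))"
        using contra by (metis of_nat_0_less_iff zero_less_Suc zero_less_divide_1_iff)
      then show ?thesis by (force simp: not_le)
    qed
    then obtain f where f: "\<And>n. f n \<in> H" "\<And>n j. j \<le> n \<Longrightarrow> norm ((deriv ^^ j) (f n) z0) < 1 / Suc n"
      by metis
    obtain g r where gr: "g holomorphic_on \<Omega>" "strict_mono (r :: nat \<Rightarrow> nat)"
      "\<And>x. x \<in> \<Omega> \<Longrightarrow> (\<lambda>n. f (r n) x) \<longlonglongrightarrow> g x"
      "\<And>K. compact K \<Longrightarrow> K \<subseteq> \<Omega> \<Longrightarrow> uniform_limit K (f \<circ> r) g sequentially"
      by (rule Montel[OF \<Omega>(1), of H f]) (use hol bd f(1) in \<open>blast+\<close>)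
    obtain e where e: "e > 0" "cball z0 e \<subseteq> \<Omega>"
      using \<Omega> z open_contains_cball by blast
    have ul: "uniform_limit (ball z0 e) (f \<circ> r) g sequentially"
      using gr(4)[OF compact_cball e(2)] uniform_limit_on_subset ball_subset_cball by blast
    have "(deriv ^^ j) g z0 = 0" for j
    proof -
      have "((\<lambda>n. (deriv ^^ j) ((f \<circ> r) n) z0) \<longlongrightarrow> (deriv ^^ j) g z0) sequentially"
      proof (rule higher_deriv_complex_uniform_limit[OF ul])
        show "\<forall>\<^sub>F n in sequentially. (f \<circ> r) n holomorphic_on ball z0 e"
          by (intro always_eventually allI)
             (use holomorphic_on_subset[OF hol[OF f(1)] order_trans[OF ball_subset_cball e(2)]] in simp)
      qed (use e in auto)
      moreover have "((\<lambda>n. (deriv ^^ j) ((f \<circ> r) n) z0) \<longlongrightarrow> 0) sequentially"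
      proof (rule Lim_null_comparison)
        show "\<forall>\<^sub>F n in sequentially. norm ((deriv ^^ j) ((f \<circ> r) n) z0) \<le> 1 / Suc n"
        proof (rule eventually_sequentiallyI[of j])
          fix n assume "j \<le> n"
          have "n \<le> r n" using gr(2) by (simp add: seq_suble)
          then have "norm ((deriv ^^ j) ((f \<circ> r) n) z0) < 1 / Suc (r n)"
            using f(2)[of j "r n"] \<open>j \<le> n\<close> by simp
          also have "\<dots> \<le> 1 / Suc n" using \<open>n \<le> r n\<close> by (simp add: frac_le)
          finally show "norm ((deriv ^^ j) ((f \<circ> r) n) z0) \<le> 1 / Suc n" by simp
        qed
        show "(\<lambda>n. 1 / real (Suc n)) \<longlonglongrightarrow> 0" by (rule lim_1_over_n[THEN LIMSEQ_Suc])
      qed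
      ultimately show ?thesis using LIMSEQ_unique by blast
    qed
    then have "g z1 = 0"
      using holomorphic_fun_eq_0_on_connected[OF gr(1) \<Omega> _ z] by auto
    moreover have "(\<lambda>n. norm (f (r n) z1)) \<longlonglongrightarrow> norm (g z1)"
      using gr(3)[OF z(2)] by (rule tendsto_norm)
    then have "\<delta> \<le> norm (g z1)"
      by (rule LIMSEQ_le_const) (use low f(1) in auto)
    ultimately show False using \<open>\<delta> > 0\<close> by simp
  qed
  then show ?thesis using that by blast
qed

text \<open>Cauchy's inequality bounds the derivative of order j + 1 uniformly over
  \<open>H\<close>. A derivative of order j that has modulus at least \<open>\<eta>\<close> at
  \<open>s0\<close> therefore keeps modulus \<open>\<eta> / 2\<close> on a ball whose radius does
  not depend on the function. After a rotation, real parts satisfy the hypotheses of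
  \<open>sublevel_cover\<close>.\<close>

lemma normal_family_sublevel_cover:
  assumes \<Omega>: "open \<Omega>" "connected \<Omega>" and z: "complex_of_real s0 \<in> \<Omega>" "z1 \<in> \<Omega>" and "\<delta> > 0"
    and hol: "\<And>h. h \<in> H \<Longrightarrow> h holomorphic_on \<Omega>"
    and bd: "\<And>h z. h \<in> H \<Longrightarrow> z \<in> \<Omega> \<Longrightarrow> norm (h z) \<le> M"
    and low: "\<And>h. h \<in> H \<Longrightarrow> \<delta> \<le> norm (h z1)"
  shows "\<exists>k \<eta> r. \<eta> > 0 \<and> r > 0 \<and> (\<forall>h\<in>H. \<forall>u. 0 < u \<and> u \<le> 1 \<longrightarrow> (\<exists>F. finite F \<and> card F < 2 ^ k \<and>
       {s \<in> ball s0 r. norm (h (complex_of_real s)) < \<eta> * u ^ k} \<subseteq> (\<Union>c\<in>F. cball c (2 * u))))"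
proof -
  obtain k \<eta> where \<eta>: "\<eta> > 0" "\<And>h. h \<in> H \<Longrightarrow> \<exists>j\<le>k. \<eta> \<le> norm ((deriv ^^ j) h (of_real s0))"
    by (rule normal_family_deriv_lower_bound[OF \<Omega> z \<open>\<delta> > 0\<close>, of H M]) (use hol bd low in \<open>blast+\<close>)
  \<comment> \<open>The factor 2 keeps the disc of radius \<open>e\<close> about every point of the
    \<open>e\<close>-ball at \<open>s0\<close> inside \<open>\<Omega>\<close>, so that Cauchy's
    inequality can be applied at all these points.\<close>
  obtain e where e: "e > 0" "cball (of_real s0) (2 * e) \<subseteq> \<Omega>"
  proof -
    obtain d where "d > 0" "cball (of_real s0) d \<subseteq> \<Omega>"
      using \<Omega> z open_contains_cball by blast
    then show ?thesis using that[of "d / 2"] by simp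
  qed
  \<comment> \<open>A common Cauchy bound for the derivatives of orders 1 to k + 1;
    \<open>max M 1\<close> makes it positive whatever the sign of \<open>M\<close>.\<close>
  define L where "L = Max ((\<lambda>j. fact (Suc j) * max M 1 / e ^ Suc j) ` {..k})"
  have Lj: "fact (Suc j) * max M 1 / e ^ Suc j \<le> L" if "j \<le> k" for j
    unfolding L_def using that by (intro Max_ge) auto
  have "L > 0" 
  proof -
    have "0 < max M 1 / e" using e by (simp add: less_max_iff_disj)
    also have "\<dots> \<le> L" using Lj[of 0] by simp
    finally show ?thesis .
  qed
  define r where "r = min e (\<eta> / (2 * L))"
  have r: "r > 0" "r \<le> e" "L * r \<le> \<eta> / 2"
    using \<open>L > 0\<close> \<eta>(1) e(1) by (auto simp: r_def min_def field_simps)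
  have "\<exists>F. finite F \<and> card F < 2 ^ k \<and>
       {s \<in> ball s0 r. norm (h (complex_of_real s)) < (\<eta> / 2) * u ^ k} \<subseteq> (\<Union>c\<in>F. cball c (2 * u))"
    if h: "h \<in> H" and u: "0 < u" "u \<le> 1" for h u
  proof -
    obtain j where j: "j \<le> k" "\<eta> \<le> norm ((deriv ^^ j) h (of_real s0))" using \<eta>(2)[OF h] by blast
    have holj: "(deriv ^^ i) h holomorphic_on \<Omega>" for i
      using hol[OF h] \<Omega>(1) by (rule holomorphic_higher_deriv)
    have der: "((deriv ^^ i) h has_field_derivative (deriv ^^ Suc i) h z) (at z)" if "z \<in> \<Omega>" for i z
      using holomorphic_derivI[OF holj \<Omega>(1) that] by simp
    define v where "v = (deriv ^^ j) h (of_real s0)"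
    \<comment> \<open>Multiplication by this unimodular number makes the derivative of order
      \<open>j\<close> at \<open>s0\<close> positive real, so its real part carries the full
      modulus.\<close>
    define \<omega> where "\<omega> = cnj v / norm v"
    have "v \<noteq> 0" using j \<eta>(1) by (auto simp: v_def)
    have \<omega>: "norm \<omega> = 1" using \<open>v \<noteq> 0\<close> by (simp add: \<omega>_def norm_divide)
    have \<omega>v: "Re (\<omega> * v) = norm v"
      using \<open>v \<noteq> 0\<close> by (simp add: \<omega>_def complex_norm_square[symmetric] mult.commute[of "cnj v"] power2_eq_square del: of_real_mult flip: of_real_divide)
    define g where "g = (\<lambda>i s. Re (\<omega> * (deriv ^^ i) h (complex_of_real s)))"
    have in\<Omega>: "z \<in> \<Omega>" if "z \<in> ball (of_real s0) e" for z
      using that e by (force simp: mem_ball mem_cball)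
    have real_in: "of_real s \<in> ball (complex_of_real s0) e" if "s \<in> ball s0 r" for s
      using that r by (simp add: dist_of_real)
    have gder: "(g i has_real_derivative g (Suc i) s) (at s)" if "s \<in> ball s0 r" for i s
    proof -
      have "((\<lambda>z. \<omega> * (deriv ^^ i) h z) has_field_derivative \<omega> * (deriv ^^ Suc i) h (of_real s)) (at (of_real s))"
        by (intro DERIV_cmult der in\<Omega> real_in that)
      then show ?thesis unfolding g_def
        by (intro has_field_derivative_Re has_vector_derivative_real_field)
    qed
    have glow: "\<eta> / 2 \<le> g j s" if s: "s \<in> ball s0 r" for s
    proof -
      have "norm ((deriv ^^ j) h (of_real s) - v) \<le> L * norm (complex_of_real s - of_real s0)"
        unfolding v_def
      proof (rule field_differentiable_bound[where S = "ball (of_real s0) e"])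
        fix z :: complex assume z: "z \<in> ball (of_real s0) e"
        then show "((deriv ^^ j) h has_field_derivative (deriv ^^ Suc j) h z) (at z within ball (of_real s0) e)"
          using der in\<Omega> has_field_derivative_at_within by blast
        have sub: "cball z e \<subseteq> \<Omega>"
        proof -
          have "cball z e \<subseteq> cball (of_real s0) (2 * e)"
            using z by (simp add: subset_iff) (smt (verit) dist_triangle)
          then show ?thesis using e by blast
        qed
        have "norm ((deriv ^^ Suc j) h z) \<le> fact (Suc j) * max M 1 / e ^ Suc j"
        proof (rule Cauchy_inequality)
          show "h holomorphic_on ball z e"
            using sub ball_subset_cball[of z e] by (blast intro: holomorphic_on_subset[OF hol[OF h]])
          show "continuous_on (cball z e) h"
            using sub by (blast intro: holomorphic_on_imp_continuous_on holomorphic_on_subset[OF hol[OF h]])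
          fix x assume "norm (z - x) = e"
          then have "x \<in> \<Omega>" using sub by (auto simp: dist_norm)
          then show "norm (h x) \<le> max M 1" using bd[OF h] by (simp add: max.coboundedI1)
        qed (use e in auto)
        also have "\<dots> \<le> L" using Lj j by auto
        finally show "norm ((deriv ^^ Suc j) h z) \<le> L" .
      qed (use s real_in e in auto)
      also have "\<dots> \<le> L * r" using \<open>L > 0\<close> s
        by (intro mult_left_mono) (auto simp: dist_norm norm_minus_commute simp flip: of_real_diff)
      finally have "norm ((deriv ^^ j) h (of_real s) - v) \<le> \<eta> / 2" using r by linarith
      then have "norm (\<omega> * ((deriv ^^ j) h (of_real s) - v)) \<le> \<eta> / 2" using \<omega> by (simp add: norm_mult)
      then have "\<bar>Re (\<omega> * ((deriv ^^ j) h (of_real s) - v))\<bar> \<le> \<eta> / 2"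
        using abs_Re_le_cmod order_trans by blast
      then have "\<bar>g j s - norm v\<bar> \<le> \<eta> / 2" using \<omega>v by (simp add: g_def algebra_simps)
      then show ?thesis using j unfolding v_def by linarith
    qed
    obtain F where F: "finite F" "card F < 2 ^ j"
      "{s \<in> ball s0 r. \<bar>g 0 s\<bar> < (\<eta> / 2) * u ^ j} \<subseteq> (\<Union>c\<in>F. cball c (2 * u))"
      using sublevel_cover[of "ball s0 r" j g "\<eta> / 2" u] gder glow \<eta>(1) u by (auto simp: is_interval_ball_real)
    \<comment> \<open>The order \<open>j\<close> depends on \<open>h\<close>. Passing to the uniform
      \<open>k\<close> only enlarges the count and, because \<open>u\<close> is at most 1, only
      shrinks the sublevel set.\<close>
    have "(2::nat) ^ j \<le> 2 ^ k" using j by (intro power_increasing) auto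
    moreover have "{s \<in> ball s0 r. norm (h (complex_of_real s)) < (\<eta> / 2) * u ^ k}
        \<subseteq> {s \<in> ball s0 r. \<bar>g 0 s\<bar> < (\<eta> / 2) * u ^ j}"
    proof -
      have "\<bar>g 0 s\<bar> \<le> norm (h (complex_of_real s))" for s
        unfolding g_def using \<omega> abs_Re_le_cmod[of "\<omega> * h (of_real s)"] by (simp add: norm_mult)
      moreover have "(\<eta> / 2) * u ^ k \<le> (\<eta> / 2) * u ^ j"
        using u j \<eta>(1) by (intro mult_left_mono power_decreasing) auto
      ultimately show ?thesis by (smt (verit) Collect_mono_iff)
    qed
    ultimately show ?thesis using F by (intro exI[of _ F] conjI) (blast | linarith)+
  qed
  then show ?thesis using \<eta>(1) r(1)
    by (intro exI[of _ k] exI[of _ "\<eta> / 2"] exI[of _ r] conjI) (simp_all del: mem_ball)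
qed

section \<open>A complex cone preserved by nearly positive matrices\<close>

text \<open>Here \<open>1\<close> is the vector with all coordinates 1. The scalars are left general
  because real words and their complexifications are compared.\<close>

definition act :: "('m \<Rightarrow> 'a::comm_semiring_1^'n^'n) \<Rightarrow> 'm list \<Rightarrow> 'a^'n::finite" where
  "act M w = foldr (\<lambda>i z. M i *v z) w 1"

lemma act_simps [simp]: "act M [] = 1" "act M (i # w) = M i *v act M w"
  by (simp_all add: act_def)

text \<open>The vectors with nonzero coordinates whose arguments differ pairwise by at most pi/4.
  The condition is unchanged under multiplication by nonzero complex scalars.\<close>

definition complex_cone :: "(complex^'n) set" where
  "complex_cone = {z. (\<forall>k. z $ k \<noteq> 0) \<and> (\<forall>k l. \<bar>Im (z $ k * cnj (z $ l))\<bar> \<le> Re (z $ k * cnj (z $ l)))}"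

lemma sum_prod_swap:
  "(\<Sum>x\<in>(UNIV :: ('n::finite \<times> 'n) set). f (fst x) (snd x)) = (\<Sum>x\<in>UNIV. f (snd x) (fst x))"
  by (rule sum.reindex_bij_witness[of _ prod.swap prod.swap]) auto

text \<open>\<open>V\<close> is the squared modulus of the sum of the coordinates of
  \<open>z\<close>. All products of a coordinate of the image with a conjugated coordinate are
  compared with this one number, independently of \<open>k\<close> and \<open>l\<close>. The first
  conclusion gives invariance of the cone, the others comparability of the coordinates of the
  image.\<close>

lemma complex_cone_gram_bounds:
  fixes M :: "complex^'n::finite^'n" and z :: "complex^'n"
  assumes a: "0 < a" and Re_M: "\<And>k p. a \<le> Re (M $ k $ p)" "\<And>k p. Re (M $ k $ p) \<le> b"
    and Im_M: "\<And>k p. \<bar>Im (M $ k $ p)\<bar> \<le> a\<^sup>2 / (6 * (a\<^sup>2 + b\<^sup>2)) * a"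
    and z: "z \<in> complex_cone"
  defines "V \<equiv> \<Sum>x\<in>UNIV. Re (z $ fst x * cnj (z $ snd x))"
  shows "\<bar>Im ((M *v z) $ k * cnj ((M *v z) $ l))\<bar> \<le> Re ((M *v z) $ k * cnj ((M *v z) $ l))"
    and "a\<^sup>2 / 2 * V \<le> Re ((M *v z) $ k * cnj ((M *v z) $ l))"
    and "Re ((M *v z) $ k * cnj ((M *v z) $ l)) \<le> 2 * b\<^sup>2 * V"
    and "0 < V"
proof -
  define X where "X = (M *v z) $ k * cnj ((M *v z) $ l)"
  \<comment> \<open>\<open>t\<close> bounds the imaginary parts of the entries relative to the real
    parts. Dropping the imaginary parts changes a product of two entries by a relative error of at
    most t^2 + 2t, hence at most 3t = \<open>\<epsilon>\<close>. \<open>\<gamma>\<close> is the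
    largest value of (x - y) / (x + y) for x, y between a^2 and b^2. The constants are tuned to
    \<open>\<gamma> + 4 * \<epsilon> = 1\<close>: since |w| is at most 2 Re w on the cone, the real
    and the imaginary part of X each carry an error of at most
    \<open>2 * \<epsilon> * T\<close>.\<close>
  define t where "t = a\<^sup>2 / (6 * (a\<^sup>2 + b\<^sup>2))"
  define \<epsilon> where "\<epsilon> = a\<^sup>2 / (2 * (a\<^sup>2 + b\<^sup>2))"
  define \<gamma> where "\<gamma> = (b\<^sup>2 - a\<^sup>2) / (a\<^sup>2 + b\<^sup>2)"
  have ab: "a \<le> b" using Re_M order_trans by blast
  have sq: "a\<^sup>2 > 0" "a\<^sup>2 \<le> b\<^sup>2" "a\<^sup>2 + b\<^sup>2 > 0" using a ab by (auto intro: power_mono add_pos_pos)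
  have "\<gamma> + 4 * \<epsilon> = (b\<^sup>2 - a\<^sup>2 + 2 * a\<^sup>2) / (a\<^sup>2 + b\<^sup>2)"
  proof -
    have "4 * (x / (2 * s)) = 2 * x / s" for x s :: real by simp
    then show ?thesis unfolding \<gamma>_def \<epsilon>_def add_divide_distrib by (simp only:)
  qed
  also have "\<dots> = 1" using sq by simp
  finally have \<gamma>\<epsilon>: "\<gamma> + 4 * \<epsilon> = 1" .
  have "x / (2 * s) = 3 * (x / (6 * s))" for x s :: real by simp
  then have "\<epsilon> = 3 * t" unfolding \<epsilon>_def t_def .
  moreover have "0 < \<epsilon>" "0 \<le> \<gamma>"
    using sq by (auto simp: \<epsilon>_def \<gamma>_def)
  ultimately have \<epsilon>: "0 < \<epsilon>" "\<epsilon> \<le> 1 / 4" "\<gamma> + 4 * \<epsilon> = 1" "0 \<le> \<gamma>" "\<epsilon> = 3 * t"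
    using \<gamma>\<epsilon> by auto
  have t: "0 < t" "t \<le> 1" using \<epsilon> by auto
  (* Up to the error e, X is the sum of r p q * w p q.  Pairing (p, q) with (q, p), where w is
     conjugated, leaves only r p q - r q p in the imaginary part; this gives the factor \<gamma> < 1. *)
  define r where "r = (\<lambda>p q. Re (M $ k $ p) * Re (M $ l $ q))"
  define e where "e = (\<lambda>p q. M $ k $ p * cnj (M $ l $ q) - of_real (r p q))"
  define w where "w = (\<lambda>p q. z $ p * cnj (z $ q))"
  have ReM0: "0 < Re (M $ k $ p)" for k p using a Re_M less_le_trans by blast
  have r: "a\<^sup>2 \<le> r p q" "r p q \<le> b\<^sup>2" for p q
    unfolding r_def power2_eq_square using a Re_M ReM0 ab by (auto intro!: mult_mono simp: less_imp_le)
  have r0: "0 < r p q" for p q using r sq less_le_trans by blast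
  have rr: "\<bar>r p q - r q p\<bar> \<le> \<gamma> * (r p q + r q p)" for p q
  proof -
    have "(r p q - r q p) \<le> \<gamma> * (r p q + r q p)" for p q
    proof -
      have "a\<^sup>2 * r p q \<le> a\<^sup>2 * b\<^sup>2" "a\<^sup>2 * b\<^sup>2 \<le> r q p * b\<^sup>2"
        using r sq by (auto intro!: mult_left_mono mult_right_mono)
      then have "(r p q - r q p) * (a\<^sup>2 + b\<^sup>2) \<le> (b\<^sup>2 - a\<^sup>2) * (r p q + r q p)"
        by (simp add: algebra_simps)
      then show ?thesis using sq by (simp add: \<gamma>_def field_simps)
    qed
    from this[of p q] this[of q p] show ?thesis by (simp add: abs_if add.commute)
  qed
  have e: "norm (e p q) \<le> \<epsilon> * r p q" for p q
  proof -
    define x y x' y' where "x = Re (M $ k $ p)" "y = Im (M $ k $ p)" "x' = Re (M $ l $ q)" "y' = Im (M $ l $ q)"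
    have x: "0 < x" "a \<le> x" "0 < x'" "a \<le> x'" using ReM0 Re_M by (auto simp: x_y_x'_y'_def)
    have y: "\<bar>y\<bar> \<le> t * x" "\<bar>y'\<bar> \<le> t * x'"
      using Im_M[of k p] Im_M[of l q] t x unfolding x_y_x'_y'_def t_def[symmetric]
      by (meson less_imp_le mult_left_mono order_trans)+
    have "e p q = of_real (y * y') + \<i> * of_real (y * x') - \<i> * of_real (x * y')"
      unfolding e_def r_def x_y_x'_y'_def by (simp add: complex_eq_iff)
    also have "norm \<dots> \<le> \<bar>y * y'\<bar> + \<bar>y * x'\<bar> + \<bar>x * y'\<bar>"
      by (rule order_trans[OF norm_triangle_ineq4] add_mono order_trans[OF norm_triangle_ineq])+
         (simp_all add: norm_mult abs_mult)
    also have "\<dots> \<le> (t * x) * (t * x') + (t * x) * x' + x * (t * x')"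
      unfolding abs_mult using y x t by (intro add_mono mult_mono) auto
    also have "\<dots> = (t * t + 2 * t) * (x * x')" by (simp add: algebra_simps)
    also have "\<dots> \<le> (3 * t) * (x * x')"
      using t x mult_left_mono[of t 1 t] by (intro mult_right_mono) auto
    finally show ?thesis using \<epsilon> by (simp add: r_def x_y_x'_y'_def)
  qed
  have w: "\<bar>Im (w p q)\<bar> \<le> Re (w p q)" "0 < Re (w p q)" "norm (w p q) \<le> 2 * Re (w p q)" for p q
  proof -
    show *: "\<bar>Im (w p q)\<bar> \<le> Re (w p q)" using z by (auto simp: w_def complex_cone_def)
    have "w p q \<noteq> 0" using z by (auto simp: w_def complex_cone_def)
    then show "0 < Re (w p q)" using * by (metis abs_ge_zero abs_le_zero_iff complex_eq_iff order.order_iff_strict order_trans zero_complex.simps)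
    show "norm (w p q) \<le> 2 * Re (w p q)" using * cmod_le[of "w p q"] by linarith
  qed
  have w_swap: "w q p = cnj (w p q)" for p q by (simp add: w_def mult.commute)
  define T where "T = (\<Sum>x\<in>UNIV. r (fst x) (snd x) * Re (w (fst x) (snd x)))"
  have X: "X = (\<Sum>x\<in>UNIV. (of_real (r (fst x) (snd x)) + e (fst x) (snd x)) * w (fst x) (snd x))"
  proof -
    have "X = (\<Sum>p\<in>UNIV. \<Sum>q\<in>UNIV. (M $ k $ p * z $ p) * cnj (M $ l $ q * z $ q))"
      unfolding X_def matrix_vector_mult_def by (simp add: sum_product)
    also have "\<dots> = (\<Sum>x\<in>UNIV. (M $ k $ fst x * z $ fst x) * cnj (M $ l $ snd x * z $ snd x))"
      by (simp add: sum.cartesian_product case_prod_beta)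
    finally show ?thesis by (simp add: e_def w_def mult_ac)
  qed
  define E where "E = (\<Sum>x\<in>UNIV. e (fst x) (snd x) * w (fst x) (snd x))"
  define Y where "Y = (\<Sum>x\<in>UNIV. r (fst x) (snd x) * Im (w (fst x) (snd x)))"
  have XE: "Re X = T + Re E" "Im X = Y + Im E"
    unfolding X E_def T_def Y_def by (simp_all add: sum.distrib distrib_right)
  have "norm E \<le> (\<Sum>x\<in>UNIV. norm (e (fst x) (snd x) * w (fst x) (snd x)))"
    unfolding E_def by (rule norm_sum)
  also have "\<dots> \<le> (\<Sum>x\<in>UNIV. (\<epsilon> * r (fst x) (snd x)) * (2 * Re (w (fst x) (snd x))))"
    unfolding norm_mult using e w(3) \<epsilon> r0 by (intro sum_mono mult_mono) (auto simp: less_imp_le)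
  also have "\<dots> = 2 * \<epsilon> * T" unfolding T_def sum_distrib_left by (simp add: mult_ac)
  finally have E: "norm E \<le> 2 * \<epsilon> * T" .
  have "2 * Y = (\<Sum>x\<in>UNIV. r (fst x) (snd x) * Im (w (fst x) (snd x)))
            + (\<Sum>x\<in>UNIV. r (snd x) (fst x) * Im (w (snd x) (fst x)))"
    unfolding Y_def sum_prod_swap[of "\<lambda>p q. r p q * Im (w p q)"] by simp
  also have "\<dots> = (\<Sum>x\<in>UNIV. (r (fst x) (snd x) - r (snd x) (fst x)) * Im (w (fst x) (snd x)))"
    unfolding w_swap[of "snd x" "fst x" for x] by (simp add: sum_subtractf left_diff_distrib sum_negf)
  also have "\<bar>\<dots>\<bar> \<le> (\<Sum>x\<in>UNIV. (\<gamma> * (r (fst x) (snd x) + r (snd x) (fst x))) * Re (w (fst x) (snd x)))"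
    by (rule order_trans[OF sum_abs], unfold abs_mult, intro sum_mono mult_mono rr w(1))
       (use r0 \<epsilon> in \<open>auto intro!: mult_nonneg_nonneg add_nonneg_nonneg simp: less_imp_le\<close>)
  also have "\<dots> = \<gamma> * (\<Sum>x\<in>UNIV. r (fst x) (snd x) * Re (w (fst x) (snd x)))
                + \<gamma> * (\<Sum>x\<in>UNIV. r (snd x) (fst x) * Re (w (snd x) (fst x)))"
    unfolding w_swap[of "snd x" "fst x" for x]
    by (simp add: sum.distrib[symmetric] sum_distrib_left algebra_simps)
  also have "\<dots> = 2 * (\<gamma> * T)"
    unfolding T_def sum_prod_swap[of "\<lambda>p q. r p q * Re (w p q)", symmetric] by simp
  finally have Y: "\<bar>Y\<bar> \<le> \<gamma> * T" by simp
  have "\<bar>Re E\<bar> \<le> 2 * \<epsilon> * T" "\<bar>Im E\<bar> \<le> 2 * \<epsilon> * T"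
    using E abs_Re_le_cmod abs_Im_le_cmod order_trans by blast+
  moreover have "\<gamma> * T + 4 * \<epsilon> * T = T" using \<epsilon>(3) by (metis distrib_right mult_1)
  ultimately have "\<bar>Im X\<bar> \<le> Re X" using XE Y by linarith
  then show "\<bar>Im ((M *v z) $ k * cnj ((M *v z) $ l))\<bar> \<le> Re ((M *v z) $ k * cnj ((M *v z) $ l))"
    by (simp only: X_def)
  show "0 < V" unfolding V_def using w(2) by (intro sum_pos) (auto simp: w_def)
  have V: "V = (\<Sum>x\<in>UNIV. Re (w (fst x) (snd x)))" by (simp only: V_def w_def)
  have TV: "a\<^sup>2 * V \<le> T" "T \<le> b\<^sup>2 * V"
    unfolding T_def V sum_distrib_left
    using w(2) r by (auto intro!: sum_mono mult_right_mono simp: less_imp_le)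
  have "0 < T" using TV(1) \<open>0 < V\<close> sq(1) by (meson less_le_trans mult_pos_pos)
  then have "\<epsilon> * T \<le> (1 / 4) * T" using \<epsilon> by (intro mult_right_mono) auto
  then have "T / 2 \<le> Re X" "Re X \<le> 2 * T"
    using XE \<open>\<bar>Re E\<bar> \<le> 2 * \<epsilon> * T\<close> \<open>0 < T\<close> by linarith+
  then show "a\<^sup>2 / 2 * V \<le> Re ((M *v z) $ k * cnj ((M *v z) $ l))"
    "Re ((M *v z) $ k * cnj ((M *v z) $ l)) \<le> 2 * b\<^sup>2 * V"
    using TV unfolding X_def[symmetric] by linarith+
qed

text \<open>With equal indices the bounds of \<open>complex_cone_gram_bounds\<close> place every
  squared modulus of a coordinate of the image between a^2 V / 2 and 2 b^2 V. The quotient of these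
  two bounds is (2b/a)^2.\<close>

lemma complex_cone_step:
  fixes M :: "complex^'n::finite^'n" and z :: "complex^'n"
  assumes a: "0 < a" and Re_M: "\<And>k p. a \<le> Re (M $ k $ p)" "\<And>k p. Re (M $ k $ p) \<le> b"
    and Im_M: "\<And>k p. \<bar>Im (M $ k $ p)\<bar> \<le> a\<^sup>2 / (6 * (a\<^sup>2 + b\<^sup>2)) * a"
    and z: "z \<in> complex_cone"
  shows "M *v z \<in> complex_cone" and "norm ((M *v z) $ k) \<le> 2 * b / a * norm ((M *v z) $ l)"
proof -
  note gram = complex_cone_gram_bounds[OF assms]
  define V where "V = (\<Sum>x\<in>UNIV. Re (z $ fst x * cnj (z $ snd x)))"
  have V: "0 < V" using gram(4) by (simp add: V_def)
  have norm2: "(norm ((M *v z) $ k))\<^sup>2 = Re ((M *v z) $ k * cnj ((M *v z) $ k))" for k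
    by (simp add: cmod_power2 flip: power2_eq_square)
  have low: "a\<^sup>2 / 2 * V \<le> (norm ((M *v z) $ k))\<^sup>2" for k
    unfolding norm2 V_def by (rule gram(2))
  have "(M *v z) $ k \<noteq> 0" for k
  proof -
    have "0 < a\<^sup>2 / 2 * V" using a V by simp
    then show ?thesis using low[of k] by auto
  qed
  then show "M *v z \<in> complex_cone" using gram(1) by (auto simp: complex_cone_def)
  have "a \<le> b" using Re_M order_trans by blast
  have "(norm ((M *v z) $ k))\<^sup>2 \<le> 2 * b\<^sup>2 * V" unfolding norm2 V_def by (rule gram(3))
  also have "\<dots> = (2 * b / a)\<^sup>2 * (a\<^sup>2 / 2 * V)" using a by (simp add: power_divide power_mult_distrib)
  also have "\<dots> \<le> (2 * b / a)\<^sup>2 * (norm ((M *v z) $ l))\<^sup>2" by (intro mult_left_mono low) simp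
  also have "\<dots> = (2 * b / a * norm ((M *v z) $ l))\<^sup>2" by (rule power_mult_distrib[symmetric])
  finally show "norm ((M *v z) $ k) \<le> 2 * b / a * norm ((M *v z) $ l)"
    using a \<open>a \<le> b\<close> by (rule_tac power2_le_imp_le) auto
qed

lemma one_in_complex_cone: "1 \<in> complex_cone"
  by (simp add: complex_cone_def)

text \<open>The ratio bound does not depend on the length of \<open>w\<close>: the tail of the word
  only has to produce a vector of the cone, and the matrix of the first letter, which is applied
  last, makes the coordinates comparable.\<close>

lemma act_complex_cone:
  assumes "0 < a" "\<And>i k p. a \<le> Re (M i $ k $ p)" "\<And>i k p. Re (M i $ k $ p) \<le> b"
    "\<And>i k p. \<bar>Im (M i $ k $ p)\<bar> \<le> a\<^sup>2 / (6 * (a\<^sup>2 + b\<^sup>2)) * a"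
  shows "act M w \<in> complex_cone"
    and "w \<noteq> [] \<Longrightarrow> norm (act M w $ k / act M w $ l) \<le> 2 * b / a"
proof -
  show *: "act M w \<in> complex_cone" for w
    by (induction w) (simp_all add: one_in_complex_cone complex_cone_step(1)[OF assms])
  assume "w \<noteq> []"
  then obtain i w' where w: "w = i # w'" by (cases w) auto
  have "norm (act M w $ k) \<le> 2 * b / a * norm (act M w $ l)"
    unfolding w act_simps by (rule complex_cone_step(2)[OF assms *])
  moreover have "act M w $ l \<noteq> 0" using *[of w] by (simp add: complex_cone_def)
  ultimately show "norm (act M w $ k / act M w $ l) \<le> 2 * b / a"
    by (simp add: norm_divide divide_le_eq)
qed

section \<open>Lines in a rank-one direction\<close>

text \<open>The balls of level n have total length at most 4 N (m/L)^(n+1). Summed over n this is of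
  order N m / L, which tends to 0 as \<open>L\<close> grows.\<close>

lemma negligible_geometric_covers:
  fixes X :: "real set" and N m :: nat
  assumes "\<And>L :: real. L \<ge> 1 \<Longrightarrow> \<exists>F :: nat \<Rightarrow> real set. (\<forall>n. finite (F n) \<and> card (F n) \<le> N * m ^ Suc n) \<and>
      X \<subseteq> (\<Union>n. \<Union>c\<in>F n. cball c (2 * (1 / L) ^ Suc n))"
  shows "negligible X"
  unfolding negligible_outer
proof (intro allI impI)
  fix e :: real assume "e > 0"
  \<comment> \<open>The entry \<open>2 * m\<close> gives the geometric series ratio at most 1/2,
    hence sum at most 2; the last entry makes the resulting bound \<open>8 * N * q\<close> smaller
    than \<open>e\<close>.\<close>
  define L where "L = max 1 (max (2 * m) (8 * N * m / e + 1))"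
  have L: "L \<ge> 1" "2 * m \<le> L" "8 * N * m / e < L" by (auto simp: L_def)
  then have L0: "L > 0" by simp
  define q where "q = m / L"
  have q: "0 \<le> q" "q \<le> 1 / 2" using L L0 by (auto simp: q_def field_simps)
  have Nq: "8 * N * q < e" using L L0 \<open>e > 0\<close> by (simp add: q_def field_simps)
  obtain F where F: "\<And>n. finite (F n)" "\<And>n. card (F n) \<le> N * m ^ Suc n"
    "X \<subseteq> (\<Union>n. \<Union>c\<in>F n. cball c (2 * (1 / L) ^ Suc n))"
    using assms[OF L(1)] by blast
  define U where "U = (\<lambda>n. \<Union>c\<in>F n. cball c (2 * (1 / L) ^ Suc n))"
  have U_meas: "U n \<in> sets lborel" for n
    unfolding U_def using F(1) by (intro sets.finite_UN) auto
  have ball_meas: "emeasure lborel (cball (c :: real) (2 * (1 / L) ^ Suc n)) = ennreal (4 * (1 / L) ^ Suc n)" for c :: real and n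
  proof -
    have "cball c (2 * (1 / L) ^ Suc n) = {c - 2 * (1 / L) ^ Suc n..c + 2 * (1 / L) ^ Suc n}"
      by (rule cball_eq_atLeastAtMost)
    then show ?thesis using L0 by (simp del: power_Suc)
  qed
  have U_bound: "emeasure lborel (U n) \<le> ennreal (4 * N * q * q ^ n)" for n
  proof -
    have "emeasure lborel (U n) \<le> (\<Sum>c\<in>F n. emeasure lborel (cball c (2 * (1 / L) ^ Suc n)))"
      unfolding U_def using F(1) by (intro emeasure_subadditive_finite) auto
    also have "\<dots> = ennreal (card (F n) * (4 * (1 / L) ^ Suc n))"
      unfolding ball_meas sum_constant ennreal_of_nat_eq_real_of_nat
      using L0 by (intro ennreal_mult[symmetric]) auto
    also have "\<dots> \<le> ennreal (real (N * m ^ Suc n) * (4 * (1 / L) ^ Suc n))"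
      using F(2)[of n] L0 by (intro ennreal_leI mult_right_mono) (simp_all only: of_nat_le_iff, simp)
    also have "real (N * m ^ Suc n) * (4 * (1 / L) ^ Suc n) = 4 * N * q * q ^ n"
      by (simp add: q_def power_divide)
    finally show ?thesis .
  qed
  have "emeasure lborel (\<Union>n. U n) \<le> (\<Sum>n. emeasure lborel (U n))"
    using U_meas by (intro emeasure_subadditive_countably) auto
  also have "\<dots> \<le> (\<Sum>n. ennreal (4 * N * q * q ^ n))"
    by (intro suminf_le U_bound) auto
  also have "\<dots> = ennreal (\<Sum>n. 4 * N * q * q ^ n)"
    using q by (intro suminf_ennreal2 summable_mult summable_geometric) auto
  also have "(\<Sum>n. 4 * N * q * q ^ n) = 4 * N * q * (1 / (1 - q))"
    using q by (subst suminf_mult) (auto simp: summable_geometric suminf_geometric)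
  also have "\<dots> \<le> 4 * N * q * 2"
    using q by (intro mult_left_mono) (auto simp: field_simps)
  finally have le: "emeasure lborel (\<Union>n. U n) \<le> ennreal (8 * N * q)" by (simp add: ennreal_leI mult_ac)
  have sets: "(\<Union>n. U n) \<in> sets lborel" using U_meas by blast
  have em: "emeasure lebesgue (\<Union>n. U n) = emeasure lborel (\<Union>n. U n)"
    using sets by (simp add: emeasure_completion)
  show "\<exists>T. X \<subseteq> T \<and> T \<in> lmeasurable \<and> measure lebesgue T < e"
  proof (intro exI conjI)
    show "X \<subseteq> (\<Union>n. U n)" using F(3) by (simp add: U_def)
    show "(\<Union>n. U n) \<in> lmeasurable"
      using sets le em by (intro fmeasurableI) (auto intro: le_less_trans)
    have "measure lebesgue (\<Union>n. U n) \<le> 8 * N * q"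
      using le q em by (simp add: measure_def enn2real_leI)
    then show "measure lebesgue (\<Union>n. U n) < e"
      using Nq by simp
  qed
qed


section \<open>Head separation and the holomorphic family of ratio differences on a line\<close>

definition head_separated :: "'n \<Rightarrow> 'n \<Rightarrow> ('n::finite,'m::finite) mtuple \<Rightarrow> bool" where
  "head_separated p q A \<longleftrightarrow> (\<exists>c>0. \<forall>w w'. length w = length w' \<and> w \<noteq> [] \<and> hd w \<noteq> hd w' \<longrightarrow>
     c ^ length w \<le> \<bar>act (($) A) w $ p / act (($) A) w $ q - act (($) A) w' $ p / act (($) A) w' $ q\<bar>)"

text \<open>The i-th matrix is the outer product of the column with \<open>c i\<close> at place
  \<open>p\<close> and 1 elsewhere with the all-ones row. Its image is spanned by that column, whose
  quotient of coordinate \<open>p\<close> by any other coordinate is \<open>c i\<close>.\<close>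

definition rank_one_tuple :: "'n \<Rightarrow> ('m \<Rightarrow> real) \<Rightarrow> ('n::finite,'m::finite) mtuple" where
  "rank_one_tuple p c = (\<chi> i k l. if k = p then c i else 1)"

definition complexified_line :: "('n::finite,'m::finite) mtuple \<Rightarrow> ('n,'m) mtuple \<Rightarrow> complex \<Rightarrow> 'm \<Rightarrow> complex^'n^'n" where
  "complexified_line A D z i = (\<chi> k l. of_real (A $ i $ k $ l) + z * of_real (D $ i $ k $ l))"

lemma act_pos:
  fixes M :: "'m \<Rightarrow> real^'n::finite^'n"
  assumes "\<And>i k l. M i $ k $ l > 0"
  shows "act M w $ k > 0"
  by (induction w arbitrary: k) (auto simp: matrix_vector_mult_def intro!: sum_pos mult_pos_pos assms)

lemma act_complexified_line_of_real:
  "act (complexified_line A D (of_real s)) w $ k = of_real (act (($) (A + s *\<^sub>R D)) w $ k)"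
  by (induction w arbitrary: k) (auto simp: matrix_vector_mult_def complexified_line_def)

lemma act_complexified_line_holomorphic:
  "(\<lambda>z. act (complexified_line A D z) w $ k) holomorphic_on S"
  by (induction w arbitrary: k)
     (auto simp: matrix_vector_mult_def complexified_line_def intro!: holomorphic_intros)

text \<open>The rank-one term sends every \<open>y\<close> to a multiple of one vector, with
  coordinate quotient exactly \<open>c i\<close>. For positive \<open>y\<close> of coordinate sum Y,
  the matrix \<open>A $ i\<close> perturbs the numerator of the difference by at most b (1 + c i) Y,
  against a denominator of at least s Y.\<close>

lemma rank_one_dominates:
  fixes A :: "('n::finite,'m::finite) mtuple"
  assumes A: "\<And>i k l. 0 < A $ i $ k $ l" "\<And>i k l. A $ i $ k $ l \<le> b"
    and c: "1 \<le> c i" and "p \<noteq> q" and s: "0 < s" "4 * (b * (1 + c i)) \<le> s"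
    and y: "\<And>k. y $ k > 0"
  shows "\<bar>(((A + s *\<^sub>R rank_one_tuple p c) $ i) *v y) $ p / (((A + s *\<^sub>R rank_one_tuple p c) $ i) *v y) $ q - c i\<bar> \<le> 1 / 4"
proof -
  define Y where "Y = (\<Sum>k\<in>UNIV. y $ k)"
  define u where "u = (\<lambda>k. ((A $ i) *v y) $ k)"
  have "Y > 0" unfolding Y_def using y by (intro sum_pos) auto
  have u: "0 \<le> u k" "u k \<le> b * Y" for k
    unfolding u_def Y_def matrix_vector_mult_def sum_distrib_left using A y
    by (auto intro!: sum_nonneg sum_mono mult_right_mono mult_nonneg_nonneg simp: less_imp_le)
  have p: "(((A + s *\<^sub>R rank_one_tuple p c) $ i) *v y) $ p = u p + s * c i * Y"
    unfolding u_def Y_def by (simp add: matrix_vector_mult_def rank_one_tuple_def distrib_right sum.distrib sum_distrib_left)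
  have q: "(((A + s *\<^sub>R rank_one_tuple p c) $ i) *v y) $ q = u q + s * Y"
    unfolding u_def Y_def using \<open>p \<noteq> q\<close>
    by (simp add: matrix_vector_mult_def rank_one_tuple_def distrib_right sum.distrib sum_distrib_left)
  have pos: "0 < u q + s * Y" using u[of q] s \<open>Y > 0\<close> by (intro add_nonneg_pos) auto
  have "\<bar>u p - c i * u q\<bar> \<le> b * Y + c i * (b * Y)"
    using u[of p] u[of q] c mult_left_mono[OF u(2), of "c i" q] mult_nonneg_nonneg[of "c i" "u q"] by linarith
  also have "\<dots> = (b * (1 + c i)) * Y" by (simp add: algebra_simps)
  also have "\<dots> \<le> (s / 4) * Y" using s \<open>Y > 0\<close> by (intro mult_right_mono) auto
  also have "\<dots> \<le> 1 / 4 * (u q + s * Y)" using u[of q] by simp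
  finally have "\<bar>(u p - c i * u q) / (u q + s * Y)\<bar> \<le> 1 / 4"
    using pos by (simp add: abs_divide divide_le_eq)
  moreover have "(u p + s * c i * Y) / (u q + s * Y) - c i = (u p - c i * u q) / (u q + s * Y)"
    using pos by (simp add: field_simps)
  ultimately show ?thesis unfolding p q by simp
qed

definition line_ratio :: "'n \<Rightarrow> 'n \<Rightarrow> ('n::finite,'m::finite) mtuple \<Rightarrow> ('n,'m) mtuple \<Rightarrow> 'm list \<Rightarrow> complex \<Rightarrow> complex" where
  "line_ratio p q A D w z = act (complexified_line A D z) w $ p / act (complexified_line A D z) w $ q"

definition ratio_differences :: "'n \<Rightarrow> 'n \<Rightarrow> ('n::finite,'m::finite) mtuple \<Rightarrow> ('n,'m) mtuple \<Rightarrow> (complex \<Rightarrow> complex) set" where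
  "ratio_differences p q A D = {(\<lambda>z. line_ratio p q A D w z - line_ratio p q A D w' z) | w w'.
     length w = length w' \<and> w \<noteq> [] \<and> hd w \<noteq> hd w'}"

text \<open>Provides the hypotheses of \<open>normal_family_sublevel_cover\<close> for all pairs of
  words at once. Holomorphy and the uniform bound come from the complex cone. The point
  \<open>z1\<close> is a large real parameter, at which each ratio lies within 1/4 of the value of
  \<open>c\<close> at its first letter; values of \<open>c\<close> at different letters are at least
  1 apart, which leaves 1/2.\<close>

lemma rank_one_line_family:
  fixes A :: "('n::finite,'m::finite) mtuple"
  assumes pos: "\<And>i k l. A $ i $ k $ l > 0" and "p \<noteq> q"
    and c: "\<And>i. 1 \<le> c i" "\<And>i j. i \<noteq> j \<Longrightarrow> 1 \<le> \<bar>c i - c j\<bar>" and "s0 > 0"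
  defines "D \<equiv> rank_one_tuple p c"
  defines "R \<equiv> line_ratio p q A D" and "H \<equiv> ratio_differences p q A D"
  obtains \<Omega> z1 M where "open \<Omega>" "connected \<Omega>" "complex_of_real s0 \<in> \<Omega>" "z1 \<in> \<Omega>"
    "\<And>h. h \<in> H \<Longrightarrow> h holomorphic_on \<Omega>" "\<And>h z. h \<in> H \<Longrightarrow> z \<in> \<Omega> \<Longrightarrow> norm (h z) \<le> M"
    "\<And>h. h \<in> H \<Longrightarrow> 1 / 2 \<le> norm (h z1)"
proof -
  define a where "a = Min (range (\<lambda>(i,k,l). A $ i $ k $ l))"
  define b0 where "b0 = Max (range (\<lambda>(i,k,l). A $ i $ k $ l))"
  define C where "C = Max (range c)"
  have "a \<in> range (\<lambda>(i,k,l). A $ i $ k $ l)" unfolding a_def by (intro Min_in) auto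
  then have a: "a > 0" using pos by auto
  have aA: "a \<le> A $ i $ k $ l" for i k l
    unfolding a_def by (intro Min_le) (auto intro!: rev_image_eqI[of "(i,k,l)"])
  have Ab: "A $ i $ k $ l \<le> b0" for i k l
    unfolding b0_def by (intro Max_ge) (auto intro!: rev_image_eqI[of "(i,k,l)"])
  have C: "c i \<le> C" for i unfolding C_def by (intro Max_ge) auto
  have "C \<ge> 1" using C c(1) order_trans by blast
  have "b0 > 0" using a aA Ab by (meson less_le_trans)
  \<comment> \<open>\<open>S\<close> is large enough for \<open>rank_one_dominates\<close> with
    every letter, and the rectangle \<open>\<Omega>\<close> contains both \<open>s0\<close> and
    \<open>S\<close>. On it the real parts of the entries stay below \<open>b\<close>, and
    \<open>\<rho>\<close> is the height at which their imaginary parts, at most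
    \<open>\<rho> * C\<close>, still meet the requirement of
    \<open>act_complex_cone\<close>.\<close>
  define S where "S = max (s0 + 1) (4 * (b0 * (1 + C)))"
  define b where "b = b0 + (S + 1) * C"
  define \<rho> where "\<rho> = a\<^sup>2 / (6 * (a\<^sup>2 + b\<^sup>2)) * a / C"
  define \<Omega> where "\<Omega> = box (Complex 0 (-\<rho>)) (Complex (S + 1) \<rho>)"
  have S: "s0 + 1 \<le> S" "4 * (b0 * (1 + C)) \<le> S" "0 < S" using \<open>s0 > 0\<close> by (auto simp: S_def)
  have \<rho>: "\<rho> > 0" unfolding \<rho>_def using a \<open>C \<ge> 1\<close>
    by (intro divide_pos_pos mult_pos_pos) (auto intro: add_pos_nonneg)
  have D: "1 \<le> D $ i $ k $ l" "D $ i $ k $ l \<le> C" for i k l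
    using c(1) C \<open>C \<ge> 1\<close> by (auto simp: D_def rank_one_tuple_def)
  have cone: "act (complexified_line A D z) w \<in> complex_cone"
    "w \<noteq> [] \<Longrightarrow> norm (R w z) \<le> 2 * b / a" if z: "z \<in> \<Omega>" for z w
  proof -
    have z': "0 < Re z" "Re z < S + 1" "\<bar>Im z\<bar> < \<rho>"
      using z by (auto simp: \<Omega>_def in_box_complex_iff)
    have 1: "a \<le> Re (complexified_line A D z i $ k $ l)" for i k l
    proof -
      have "0 \<le> Re z * D $ i $ k $ l"
        using z'(1) D(1)[of i k l] by (intro mult_nonneg_nonneg) auto
      then show ?thesis using aA[of i k l] by (simp add: complexified_line_def)
    qed
    have 2: "Re (complexified_line A D z i $ k $ l) \<le> b" for i k l
      using Ab[of i k l] mult_mono[of "Re z" "S + 1" "D $ i $ k $ l" C] D[of i k l] z' S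
      by (simp add: complexified_line_def b_def)
    have 3: "\<bar>Im (complexified_line A D z i $ k $ l)\<bar> \<le> a\<^sup>2 / (6 * (a\<^sup>2 + b\<^sup>2)) * a" for i k l
    proof -
      have "\<bar>Im (complexified_line A D z i $ k $ l)\<bar> = \<bar>Im z\<bar> * D $ i $ k $ l"
        using D(1)[of i k l] by (simp add: complexified_line_def abs_mult)
      also have "\<dots> \<le> \<rho> * C" using z' D[of i k l] \<rho> by (intro mult_mono) auto
      also have "\<dots> = a\<^sup>2 / (6 * (a\<^sup>2 + b\<^sup>2)) * a" 
      proof -
        have "x / C * C = x" for x using \<open>C \<ge> 1\<close> by simp
        then show ?thesis by (simp only: \<rho>_def)
      qed
      finally show ?thesis .
    qed
    show "act (complexified_line A D z) w \<in> complex_cone"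
      by (rule act_complex_cone(1)[OF a 1 2 3])
    show "norm (R w z) \<le> 2 * b / a" if "w \<noteq> []"
      unfolding R_def line_ratio_def by (rule act_complex_cone(2)[OF a 1 2 3 that])
  qed
  have Rhol: "R w holomorphic_on \<Omega>" for w
    unfolding R_def line_ratio_def using cone(1)
    by (intro holomorphic_on_divide act_complexified_line_holomorphic) (auto simp: complex_cone_def)
  have near: "\<bar>act (($) (A + S *\<^sub>R D)) w $ p / act (($) (A + S *\<^sub>R D)) w $ q - c (hd w)\<bar> \<le> 1 / 4"
    if "w \<noteq> []" for w
  proof -
    obtain i w' where w: "w = i # w'" using \<open>w \<noteq> []\<close> by (cases w) auto
    have "0 < (A + S *\<^sub>R D) $ i $ k $ l" for i k l
      using pos[of i k l] S(3) D(1)[of i k l] by (simp add: add_pos_pos)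
    then have y: "act (($) (A + S *\<^sub>R D)) w' $ k > 0" for k by (rule act_pos)
    have "4 * (b0 * (1 + c i)) \<le> 4 * (b0 * (1 + C))"
      using C[of i] \<open>b0 > 0\<close> by simp
    then have "4 * (b0 * (1 + c i)) \<le> S" using S by linarith
    then show ?thesis unfolding w act_simps list.sel D_def
      by (intro rank_one_dominates[where b = b0] pos Ab c(1) \<open>p \<noteq> q\<close> S(3) y[unfolded D_def])
  qed
  show ?thesis
  proof (rule that)
    show "open \<Omega>" "connected \<Omega>" by (auto simp: \<Omega>_def open_box intro: convex_connected convex_box)
    show "complex_of_real s0 \<in> \<Omega>" "complex_of_real S \<in> \<Omega>"
      using \<rho> S \<open>s0 > 0\<close> by (auto simp: \<Omega>_def in_box_complex_iff)
    fix h assume "h \<in> H"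
    then obtain w w' where h: "h = (\<lambda>z. R w z - R w' z)" and w: "length w = length w'" "w \<noteq> []" "hd w \<noteq> hd w'"
      unfolding H_def R_def ratio_differences_def by blast
    have w': "w' \<noteq> []" using w by auto
    show "h holomorphic_on \<Omega>" unfolding h by (intro holomorphic_on_diff Rhol)
    show "norm (h z) \<le> 2 * b / a + 2 * b / a" if "z \<in> \<Omega>" for z
      unfolding h by (rule order_trans[OF norm_triangle_ineq4 add_mono[OF cone(2)[OF that w(2)] cone(2)[OF that w']]])
    have "h (of_real S) = of_real (act (($) (A + S *\<^sub>R D)) w $ p / act (($) (A + S *\<^sub>R D)) w $ q
        - act (($) (A + S *\<^sub>R D)) w' $ p / act (($) (A + S *\<^sub>R D)) w' $ q)"
      by (simp add: h R_def line_ratio_def act_complexified_line_of_real)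
    then have "norm (h (of_real S)) = \<bar>act (($) (A + S *\<^sub>R D)) w $ p / act (($) (A + S *\<^sub>R D)) w $ q
        - act (($) (A + S *\<^sub>R D)) w' $ p / act (($) (A + S *\<^sub>R D)) w' $ q\<bar>"
      by (simp only: norm_of_real)
    then show "1 / 2 \<le> norm (h (of_real S))"
      using near[OF w(2)] near[OF w'] c(2)[OF w(3)] by linarith
  qed
qed

text \<open>It suffices to argue near each \<open>s0\<close>, where \<open>k\<close>,
  \<open>\<eta>\<close> and \<open>r\<close> are the same for all pairs of words. For words of
  length n + 1 the sublevel sets are taken with u = L^-(n+1). There are at most m^(2(n+1)) pairs,
  each costing fewer than 2^k balls, as \<open>negligible_geometric_covers\<close> requires. A
  parameter outside all these balls is head separated with a constant of order L^-k.\<close>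

lemma rank_one_line_negligible:
  fixes A :: "('n::finite,'m::finite) mtuple"
  assumes pos: "\<And>i k l. A $ i $ k $ l > 0" and "p \<noteq> q"
    and c: "\<And>i. 1 \<le> c i" "\<And>i j. i \<noteq> j \<Longrightarrow> 1 \<le> \<bar>c i - c j\<bar>"
  shows "negligible {s. s > 0 \<and> \<not> head_separated p q (A + s *\<^sub>R rank_one_tuple p c)}"
    (is "negligible ?X")
  unfolding locally_negligible_alt[of ?X]
proof
  fix s0 assume "s0 \<in> ?X"
  then have "s0 > 0" by simp
  define D where "D = (rank_one_tuple p c :: ('n,'m) mtuple)"
  define R where "R = line_ratio p q A D"
  define H where "H = ratio_differences p q A D"
  obtain \<Omega> z1 M where fam: "open \<Omega>" "connected \<Omega>" "complex_of_real s0 \<in> \<Omega>" "z1 \<in> \<Omega>"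
    "\<And>h. h \<in> H \<Longrightarrow> h holomorphic_on \<Omega>" "\<And>h z. h \<in> H \<Longrightarrow> z \<in> \<Omega> \<Longrightarrow> norm (h z) \<le> M"
    "\<And>h. h \<in> H \<Longrightarrow> 1 / 2 \<le> norm (h z1)"
    by (rule rank_one_line_family[of A p q c s0, OF pos \<open>p \<noteq> q\<close> c \<open>s0 > 0\<close>, folded D_def, folded H_def], assumption, rule that)
  have half: "(0 :: real) < 1 / 2" by simp
  have "\<exists>k \<eta> r. \<eta> > 0 \<and> r > 0 \<and> (\<forall>h\<in>H. \<forall>u. 0 < u \<and> u \<le> 1 \<longrightarrow> (\<exists>F. finite F \<and> card F < 2 ^ k \<and>
       {s \<in> ball s0 r. norm (h (complex_of_real s)) < \<eta> * u ^ k} \<subseteq> (\<Union>c\<in>F. cball c (2 * u))))"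
    by (rule normal_family_sublevel_cover[of \<Omega> s0 z1 "1 / 2" H M]) (fact fam half)+
  then obtain k \<eta> r where *: "\<eta> > 0 \<and> r > 0 \<and> (\<forall>h\<in>H. \<forall>u. 0 < u \<and> u \<le> 1 \<longrightarrow> (\<exists>F. finite F \<and> card F < 2 ^ k \<and>
       {s \<in> ball s0 r. norm (h (complex_of_real s)) < \<eta> * u ^ k} \<subseteq> (\<Union>c\<in>F. cball c (2 * u))))"
    by (elim exE)
  note \<eta>r = conjunct1[OF *] conjunct1[OF conjunct2[OF *]]
  note cover = conjunct2[OF conjunct2[OF *], rule_format, OF _ conjI]
  \<comment> \<open>Level \<open>n\<close> collects words of length n + 1, since the empty word has
    no first letter.\<close>
  define P :: "nat \<Rightarrow> ('m list \<times> 'm list) set" where "P = (\<lambda>n. {(w, w'). length w = Suc n \<and> length w' = Suc n \<and> hd w \<noteq> hd w'})"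
  have lists: "finite {w :: 'm list. length w = n}" "card {w :: 'm list. length w = n} = CARD('m) ^ n" for n
    using finite_lists_length_eq[of "UNIV :: 'm set" n] card_lists_length_eq[of "UNIV :: 'm set" n] by simp_all
  have Psub: "P n \<subseteq> {w. length w = Suc n} \<times> {w. length w = Suc n}" for n by (auto simp: P_def)
  have P: "finite (P n)" "card (P n) \<le> (CARD('m)\<^sup>2) ^ Suc n" for n
  proof -
    show "finite (P n)" using Psub lists by (meson finite_SigmaI finite_subset)
    have "card (P n) \<le> card ({w :: 'm list. length w = Suc n} \<times> {w :: 'm list. length w = Suc n})"
      using Psub lists by (intro card_mono) auto
    also have "\<dots> = (CARD('m)\<^sup>2) ^ Suc n"
      unfolding card_cartesian_product lists(2) by (simp only: power2_eq_square power_mult_distrib)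
    finally show "card (P n) \<le> (CARD('m)\<^sup>2) ^ Suc n" .
  qed
  have "negligible (?X \<inter> ball s0 r)"
  proof (rule negligible_geometric_covers)
    fix L :: real assume L: "L \<ge> 1"
    define bad where "bad = (\<lambda>n x. {s \<in> ball s0 r.
       norm (R (fst x) (of_real s) - R (snd x) (of_real s)) < \<eta> * ((1 / L) ^ Suc n) ^ k})"
    define G where "G = (\<lambda>n x. SOME F. finite F \<and> card F < 2 ^ k \<and>
       bad n x \<subseteq> (\<Union>c\<in>F. cball c (2 * (1 / L) ^ Suc n)))"
    have G: "finite (G n x) \<and> card (G n x) < 2 ^ k \<and>
       bad n x \<subseteq> (\<Union>c\<in>G n x. cball c (2 * (1 / L) ^ Suc n))" if "x \<in> P n" for n x
    proof -
      have "(\<lambda>z. R (fst x) z - R (snd x) z) \<in> H"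
        using that unfolding H_def R_def ratio_differences_def P_def
        by (intro CollectI exI[of _ "fst x"] exI[of _ "snd x"]) auto
      moreover have "0 < (1 / L) ^ Suc n" "(1 / L) ^ Suc n \<le> 1"
        using L by (simp_all add: power_le_one del: power_Suc)
      ultimately have "\<exists>F. finite F \<and> card F < 2 ^ k \<and> bad n x \<subseteq> (\<Union>c\<in>F. cball c (2 * (1 / L) ^ Suc n))"
        unfolding bad_def by (rule cover)
      then show ?thesis unfolding G_def by (rule someI_ex)
    qed
    define F where "F = (\<lambda>n. \<Union>x\<in>P n. G n x)"
    have "card (F n) \<le> 2 ^ k * (CARD('m)\<^sup>2) ^ Suc n" for n
    proof -
      have "card (F n) \<le> (\<Sum>x\<in>P n. card (G n x))" unfolding F_def using P(1) by (rule card_UN_le)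
      also have "\<dots> \<le> card (P n) * 2 ^ k"
        using sum_bounded_above[of "P n" "\<lambda>x. card (G n x)" "2 ^ k"] G by (simp add: less_imp_le)
      also have "\<dots> \<le> 2 ^ k * (CARD('m)\<^sup>2) ^ Suc n" using P(2) by (simp add: mult.commute)
      finally show ?thesis .
    qed
    moreover have "finite (F n)" for n unfolding F_def using P(1) G by blast
    moreover have "?X \<inter> ball s0 r \<subseteq> (\<Union>n. \<Union>c\<in>F n. cball c (2 * (1 / L) ^ Suc n))"
    proof (rule ccontr)
      assume "\<not> ?thesis"
      then obtain s where s: "s \<in> ?X" "s \<in> ball s0 r" "\<And>n. s \<notin> (\<Union>c\<in>F n. cball c (2 * (1 / L) ^ Suc n))"
        by blast
      \<comment> \<open>The minimum with 1 ensures that all powers with positive exponent of this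
        factor stay below \<open>\<eta>\<close>, so the single factor \<open>\<eta>\<close> of the
        sublevel bound is absorbed into an exponential one.\<close>
      define e where "e = min \<eta> 1 * (1 / L) ^ k"
      have "e > 0" using \<eta>r L by (simp add: e_def)
      have "e ^ length w \<le> \<bar>act (($) (A + s *\<^sub>R D)) w $ p / act (($) (A + s *\<^sub>R D)) w $ q
        - act (($) (A + s *\<^sub>R D)) w' $ p / act (($) (A + s *\<^sub>R D)) w' $ q\<bar>"
        if w: "length w = length w' \<and> w \<noteq> [] \<and> hd w \<noteq> hd w'" for w w'
      proof -
        obtain n where n: "length w = Suc n" using w by (metis length_0_conv not0_implies_Suc)
        then have "(w, w') \<in> P n" using w by (auto simp: P_def)
        then have "s \<notin> (\<Union>c\<in>G n (w, w'). cball c (2 * (1 / L) ^ Suc n))"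
          using s(3)[of n] unfolding F_def by blast
        then have "\<eta> * ((1 / L) ^ Suc n) ^ k \<le> norm (R w (of_real s) - R w' (of_real s))"
          using G[OF \<open>(w, w') \<in> P n\<close>] s(2) unfolding bad_def fst_conv snd_conv by (blast intro: leI)
        also have "R w (of_real s) - R w' (of_real s) = of_real (act (($) (A + s *\<^sub>R D)) w $ p / act (($) (A + s *\<^sub>R D)) w $ q
        - act (($) (A + s *\<^sub>R D)) w' $ p / act (($) (A + s *\<^sub>R D)) w' $ q)"
          by (simp add: R_def line_ratio_def act_complexified_line_of_real)
        finally have *: "\<eta> * ((1 / L) ^ Suc n) ^ k \<le> \<bar>act (($) (A + s *\<^sub>R D)) w $ p / act (($) (A + s *\<^sub>R D)) w $ q
        - act (($) (A + s *\<^sub>R D)) w' $ p / act (($) (A + s *\<^sub>R D)) w' $ q\<bar>"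
          by (simp only: norm_of_real)
        have "min \<eta> 1 ^ Suc n \<le> min \<eta> 1 ^ 1" using \<eta>r by (intro power_decreasing) auto
        also have "\<dots> \<le> \<eta>" by simp
        finally have "min \<eta> 1 ^ Suc n * ((1 / L) ^ k) ^ Suc n \<le> \<eta> * ((1 / L) ^ k) ^ Suc n"
          using L by (intro mult_right_mono) auto
        then have "e ^ length w \<le> \<eta> * ((1 / L) ^ Suc n) ^ k"
          unfolding n e_def power_mult_distrib by (simp only: power_mult[symmetric] mult.commute)
        then show ?thesis using * by linarith
      qed
      then have "head_separated p q (A + s *\<^sub>R D)"
        unfolding head_separated_def using \<open>e > 0\<close> by blast
      then show False using s(1) by (simp add: D_def)
    qed
    ultimately show "\<exists>F. (\<forall>n. finite (F n) \<and> card (F n) \<le> 2 ^ k * (CARD('m)\<^sup>2) ^ Suc n) \<and>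
      ?X \<inter> ball s0 r \<subseteq> (\<Union>n. \<Union>c\<in>F n. cball c (2 * (1 / L) ^ Suc n))"
      by blast
  qed
  then show "\<exists>U. openin (top_of_set ?X) U \<and> s0 \<in> U \<and> negligible U"
    using \<open>s0 \<in> ?X\<close> \<eta>r by (intro exI[of _ "?X \<inter> ball s0 r"]) auto
qed

section \<open>Almost every positive tuple is strongly Diophantine\<close>

text \<open>With the constant restricted to the values 1/(j+1), the condition is a countable
  combination of inequalities between measurable functions, because there are only countably many
  words.\<close>

lemma head_separated_nat:
  "head_separated p q A \<longleftrightarrow> (\<exists>j::nat. \<forall>w w'. length w = length w' \<and> w \<noteq> [] \<and> hd w \<noteq> hd w' \<longrightarrow>
     (1 / Suc j) ^ length w \<le> \<bar>act (($) A) w $ p / act (($) A) w $ q - act (($) A) w' $ p / act (($) A) w' $ q\<bar>)"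
  (is "_ \<longleftrightarrow> (\<exists>j. ?Q (1 / Suc j))")
proof
  assume "head_separated p q A"
  then obtain c where c: "c > 0" "?Q c" unfolding head_separated_def by blast
  obtain j where j: "1 / Suc j < c" using nat_approx_posE[OF c(1)] by blast
  have "(1 / Suc j) ^ n \<le> c ^ n" for n using j by (intro power_mono) auto
  then have "?Q (1 / Suc j)" using c(2) order_trans by blast
  then show "\<exists>j. ?Q (1 / Suc j)" ..
next
  assume "\<exists>j. ?Q (1 / Suc j)"
  then obtain j :: nat where "?Q (1 / Suc j)" by blast
  moreover have "0 < 1 / real (Suc j)" by simp
  ultimately show "head_separated p q A" unfolding head_separated_def by blast
qed

lemma act_measurable [measurable]:
  "(\<lambda>A :: ('n::finite,'m::finite) mtuple. act (($) A) w $ k) \<in> borel_measurable borel"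
proof (rule borel_measurable_continuous_onI)
  show "continuous_on UNIV (\<lambda>A :: ('n,'m) mtuple. act (($) A) w $ k)"
  proof (induction w arbitrary: k)
    case (Cons i w)
    then show ?case unfolding act_simps matrix_vector_mult_def vec_lambda_beta
      by (intro continuous_on_sum continuous_on_mult Cons.IH continuous_on_component continuous_on_id)
  qed simp
qed

lemma head_separated_measurable [measurable]:
  "Measurable.pred borel (\<lambda>A :: ('n::finite,'m::finite) mtuple. head_separated p q A)"
  unfolding head_separated_nat by measurable

definition pos_tuple :: "('n::finite,'m::finite) mtuple \<Rightarrow> bool" where
  "pos_tuple A \<longleftrightarrow> (\<forall>i k l. A $ i $ k $ l > 0)"

lemma pos_tuple_measurable [measurable]: "Measurable.pred borel pos_tuple"
proof -
  have [measurable]: "(\<lambda>A :: ('n::finite,'m::finite) mtuple. A $ i $ k $ l) \<in> borel_measurable borel" for i k l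
    by (intro borel_measurable_continuous_onI continuous_intros)
  show ?thesis unfolding pos_tuple_def[abs_def] by measurable
qed

lemma AE_lborel_interval_ex:
  assumes "AE s in lborel. Q (s :: real)" "e > 0"
  shows "\<exists>s. 0 < s \<and> s < e \<and> Q s"
proof (rule ccontr)
  assume "\<not> ?thesis"
  then have "AE s in lborel. s \<notin> {0<..<e}"
    using assms(1) by (auto elim!: eventually_mono)
  then have "emeasure lborel {0<..<e} = 0"
    by (subst (asm) AE_iff_measurable[of "{0<..<e}"]) auto
  then show False using \<open>e > 0\<close> by simp
qed

text \<open>By Fubini, for almost every s > 0 the tuple A + sD is head separated for almost every
  positive A. Take such parameters \<open>s n\<close> tending to 0. Every positive A equals (A - s n
  D) + s n D with A - s n D still positive once n is large, so the bad tuples lie in countably many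
  translates of null sets.\<close>

lemma pos_tuple_not_head_separated_negligible:
  assumes "p \<noteq> q"
  shows "negligible {A :: ('n::finite,'m::finite) mtuple. pos_tuple A \<and> \<not> head_separated p q A}"
    (is "negligible ?N")
proof -
  obtain f :: "'m \<Rightarrow> nat" where f: "inj f"
    using finite_imp_inj_to_nat_seg[OF finite] by blast
  \<comment> \<open>Distinct naturals shifted by 1: all values are at least 1 and lie at mutual
    distance at least 1.\<close>
  define c where "c = (\<lambda>i. 1 + real (f i))"
  define C where "C = Max (range c)"
  define D :: "('n,'m) mtuple" where "D = rank_one_tuple p c"
  have c: "1 \<le> c i" "i \<noteq> j \<Longrightarrow> 1 \<le> \<bar>c i - c j\<bar>" for i j
  proof -
    show "1 \<le> c i" by (simp add: c_def)
    assume "i \<noteq> j"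
    then have "f i < f j \<or> f j < f i" using f by (metis injD linorder_neqE_nat)
    then show "1 \<le> \<bar>c i - c j\<bar>" by (auto simp: c_def)
  qed
  have C: "c i \<le> C" for i unfolding C_def by (intro Max_ge) auto
  then have "C \<ge> 1" using c(1) order_trans by blast
  have D: "D $ i $ k $ l \<le> C" for i k l using C \<open>C \<ge> 1\<close> by (simp add: D_def rank_one_tuple_def)
  define good where "good = (\<lambda>s. AE A :: ('n,'m) mtuple in lborel.
      s > 0 \<longrightarrow> pos_tuple A \<longrightarrow> head_separated p q (A + s *\<^sub>R D))"
  have "AE s in lborel. s > 0 \<longrightarrow> pos_tuple A \<longrightarrow> head_separated p q (A + s *\<^sub>R D)" for A :: "('n,'m) mtuple"
  proof (cases "pos_tuple A")
    case True
    have "negligible {s. s > 0 \<and> \<not> head_separated p q (A + s *\<^sub>R D)}"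
      unfolding D_def
      by (rule rank_one_line_negligible[of A p q c]) (use True \<open>p \<noteq> q\<close> c in \<open>simp_all add: pos_tuple_def\<close>)
    moreover have "{s. s > 0 \<and> \<not> head_separated p q (A + s *\<^sub>R D)} \<in> sets lborel"
      by measurable
    ultimately have "{s. s > 0 \<and> \<not> head_separated p q (A + s *\<^sub>R D)} \<in> null_sets lborel"
      using negligible_iff_null_sets null_sets_completion_iff by blast
    then show ?thesis by (rule AE_I') auto
  qed simp
  then have "AE A :: ('n,'m) mtuple in lborel. AE s in lborel. s > 0 \<longrightarrow> pos_tuple A \<longrightarrow> head_separated p q (A + s *\<^sub>R D)"
    by simp
  then have "AE s in lborel. AE A :: ('n,'m) mtuple in lborel. s > 0 \<longrightarrow> pos_tuple A \<longrightarrow> head_separated p q (A + s *\<^sub>R D)"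
  proof (subst lborel_pair.AE_commute[symmetric])
    have "Measurable.pred (lborel \<Otimes>\<^sub>M lborel)
        (\<lambda>x :: ('n,'m) mtuple \<times> real. snd x > 0 \<longrightarrow> pos_tuple (fst x) \<longrightarrow> head_separated p q (fst x + snd x *\<^sub>R D))"
      by measurable
    then show "{x \<in> space (lborel \<Otimes>\<^sub>M lborel). snd x > 0 \<longrightarrow> pos_tuple (fst x :: ('n,'m) mtuple) \<longrightarrow>
        head_separated p q (fst x + snd x *\<^sub>R D)} \<in> sets (lborel \<Otimes>\<^sub>M lborel)"
      unfolding pred_def .
  qed
  then have ae: "AE s in lborel. good s"
    unfolding good_def .
  define s where "s = (\<lambda>n. SOME s. 0 < s \<and> s < 1 / Suc n \<and> good s)"
  have "0 < s n \<and> s n < 1 / Suc n \<and> good (s n)" for n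
  proof -
    have "\<exists>s. 0 < s \<and> s < 1 / Suc n \<and> good s" by (rule AE_lborel_interval_ex[OF ae]) simp
    then show ?thesis unfolding s_def by (rule someI_ex)
  qed
  then have s: "\<And>n. 0 < s n" "\<And>n. s n < 1 / Suc n" "\<And>n. good (s n)" by simp_all
  define E where "E = (\<lambda>n. {A :: ('n,'m) mtuple. pos_tuple A \<and> \<not> head_separated p q (A + s n *\<^sub>R D)})"
  have E: "negligible (E n)" for n
  proof -
    have "AE A in lborel. A \<notin> E n"
      using s(3)[of n, unfolded good_def] by eventually_elim (use s(1)[of n] in \<open>simp add: E_def\<close>)
    moreover have "E n \<in> sets lborel" unfolding E_def by measurable
    ultimately have "E n \<in> null_sets lborel" by (simp add: AE_iff_null_sets)
    then show ?thesis by (simp add: negligible_iff_null_sets null_sets_completionI)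
  qed
  have "?N \<subseteq> (\<Union>n. (+) (s n *\<^sub>R D) ` E n)"
  proof
    fix A assume A: "A \<in> ?N"
    define a where "a = Min (range (\<lambda>(i,k,l). A $ i $ k $ l))"
    have "a \<in> range (\<lambda>(i,k,l). A $ i $ k $ l)" unfolding a_def by (intro Min_in) auto
    then have a: "a > 0" using A by (auto simp: pos_tuple_def)
    have aA: "a \<le> A $ i $ k $ l" for i k l
      unfolding a_def by (intro Min_le) (auto intro!: rev_image_eqI[of "(i,k,l)"])
    obtain n where n: "1 / Suc n < a / C" 
    proof (rule nat_approx_posE)
      show "0 < a / C" using a \<open>C \<ge> 1\<close> by simp
    qed (rule that)
    have "s n < a / C" using n s(2)[of n] by linarith
    then have "s n * C < a" using \<open>C \<ge> 1\<close> by (simp add: pos_less_divide_eq)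
    have "0 < (A - s n *\<^sub>R D) $ i $ k $ l" for i k l
    proof -
      have "s n * D $ i $ k $ l \<le> s n * C" using D s(1)[of n] by (intro mult_left_mono) auto
      then show ?thesis using \<open>s n * C < a\<close> aA[of i k l] by simp
    qed
    then have "A - s n *\<^sub>R D \<in> E n" using A by (simp add: E_def pos_tuple_def)
    then show "A \<in> (\<Union>n. (+) (s n *\<^sub>R D) ` E n)"
      by (intro UN_I[of n]) (auto intro!: rev_image_eqI)
  qed
  moreover have "negligible (\<Union>n. (+) (s n *\<^sub>R D) ` E n)"
    by (rule negligible_Union_nat[OF negligible_translation[OF E]])
  ultimately show ?thesis by (rule negligible_subset[rotated])
qed

section \<open>From head separation to the strong Diophantine property\<close>

lemma act_bounds:
  fixes a b :: real and M :: "'m \<Rightarrow> real^'n::finite^'n"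
  assumes "0 < a" "\<And>i k l. a \<le> M i $ k $ l" "\<And>i k l. M i $ k $ l \<le> b"
  shows "a ^ length w \<le> act M w $ k" "act M w $ k \<le> (CARD('n) * b) ^ length w"
proof -
  have b: "0 < b" using assms by (meson less_le_trans)
  have pos: "0 < act M w $ k" for w k by (rule act_pos) (use assms in \<open>meson less_le_trans\<close>)
  show "a ^ length w \<le> act M w $ k"
  proof (induction w arbitrary: k)
    case (Cons i w)
    have "a * a ^ length w \<le> M i $ k $ k * act M w $ k"
      using assms Cons order_trans[OF less_imp_le[OF assms(1)] assms(2)] by (intro mult_mono) auto
    also have "\<dots> \<le> (\<Sum>l\<in>UNIV. M i $ k $ l * act M w $ l)"
      using order_trans[OF less_imp_le[OF assms(1)] assms(2)] less_imp_le[OF pos] by (intro member_le_sum) auto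
    finally show ?case by (simp add: matrix_vector_mult_def)
  qed simp
  show "act M w $ k \<le> (CARD('n) * b) ^ length w"
  proof (induction w arbitrary: k)
    case (Cons i w)
    have "act M (i # w) $ k \<le> (\<Sum>l\<in>(UNIV :: 'n set). b * (CARD('n) * b) ^ length w)"
      unfolding act_simps matrix_vector_mult_def vec_lambda_beta
      using assms(3) Cons less_imp_le[OF pos] less_imp_le[OF b] by (intro sum_mono mult_mono) auto
    then show ?case by (simp add: mult.assoc)
  qed simp
qed

lemma word_prod_append: "word_prod A (u @ w) = word_prod A u ** word_prod A w"
  by (induction u) (auto simp: word_prod_def matrix_mul_assoc)

lemma word_prod_act: "word_prod A w *v 1 = act (($) A) w"
  by (induction w) (auto simp: word_prod_def matrix_vector_mul_assoc[symmetric])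

text \<open>Two distinct words of equal length share a prefix u and then have different letters. On
  the vector \<open>1\<close>, the difference of their products is the product along u applied to a
  difference of two \<open>act\<close> vectors with different heads. The prefix shrinks norms by at
  most r^|u|, and for the rest the gap between coordinate quotients becomes a gap in norm.\<close>

lemma head_separated_imp_strongly_diophantine:
  fixes A :: "('n::finite,'m::finite) mtuple"
  assumes pos: "pos_tuple A" and inv: "\<And>i. invertible (A $ i)" and sep: "head_separated p q A"
  shows "strongly_diophantine A"
proof -
  define a where "a = Min (range (\<lambda>(i,k,l). A $ i $ k $ l))"
  define b where "b = CARD('n) * Max (range (\<lambda>(i,k,l). A $ i $ k $ l))"
  have "a \<in> range (\<lambda>(i,k,l). A $ i $ k $ l)" unfolding a_def by (intro Min_in) auto
  then have a: "a > 0" using pos by (auto simp: pos_tuple_def)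
  have aA: "a \<le> A $ i $ k $ l" for i k l
    unfolding a_def by (intro Min_le) (auto intro!: rev_image_eqI[of "(i,k,l)"])
  have Ab: "A $ i $ k $ l \<le> Max (range (\<lambda>(i,k,l). A $ i $ k $ l))" for i k l
    by (intro Max_ge) (auto intro!: rev_image_eqI[of "(i,k,l)"])
  note y = act_bounds[of a "($) A", OF a aA Ab, folded b_def]
  have "0 < Max (range (\<lambda>(i,k,l). A $ i $ k $ l))"
    using a aA Ab by (meson less_le_trans)
  then have b: "b > 0" by (simp add: b_def)
  obtain c where c: "c > 0" and sep: "\<And>w w'. length w = length w' \<Longrightarrow> w \<noteq> [] \<Longrightarrow> hd w \<noteq> hd w' \<Longrightarrow>
     c ^ length w \<le> \<bar>act (($) A) w $ p / act (($) A) w $ q - act (($) A) w' $ p / act (($) A) w' $ q\<bar>"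
    using sep unfolding head_separated_def by blast
  have "\<exists>r>0. \<forall>x. r * norm x \<le> norm (A $ i *v x)" for i
  proof -
    have "inj ((*v) (A $ i))" using inv[of i] by (simp add: invertible_eq_bij bij_is_inj)
    then show ?thesis
      using linear_inj_bounded_below_pos[of "(*v) (A $ i)"] by (metis matrix_vector_mul_linear)
  qed
  then obtain r' where r': "\<And>i. r' i > 0" "\<And>i x. r' i * norm x \<le> norm (A $ i *v x)" by metis
  define r where "r = Min (range r')"
  have "r \<in> range r'" unfolding r_def by (intro Min_in) auto
  then have r0: "r > 0" using r'(1) by auto
  have "r \<le> r' i" for i unfolding r_def by (intro Min_le) auto
  then have r: "r * norm x \<le> norm (A $ i *v x)" for i x
    using r'(2) by (meson mult_right_mono norm_ge_zero order_trans)
  have word_low: "r ^ length u * norm x \<le> norm (word_prod A u *v x)" for u x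
  proof (induction u)
    case (Cons i u)
    have "r ^ length (i # u) * norm x \<le> r * norm (word_prod A u *v x)"
      using Cons r0 by (simp add: mult.assoc)
    also have "\<dots> \<le> norm (word_prod A (i # u) *v x)"
      using r by (simp add: word_prod_def matrix_vector_mul_assoc[symmetric])
    finally show ?case .
  qed (simp add: word_prod_def)
  \<comment> \<open>Clearing denominators in the quotient gap gives c^n a^(2n) as a lower bound for
    2 b^n times the norm of the difference, since coordinates lie between a^n and b^n.\<close>
  define e where "e = c * a\<^sup>2 / b"
  have e: "e > 0" using a b c by (simp add: e_def)
  have diff_low: "e ^ length w / 2 \<le> norm (act (($) A) w - act (($) A) w')"
    if w: "length w = length w'" "w \<noteq> []" "hd w \<noteq> hd w'" for w w'
  proof -
    define n y1 y2 where "n = length w" "y1 = act (($) A) w" "y2 = act (($) A) w'"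
    have y1: "a ^ n \<le> y1 $ k" "y1 $ k \<le> b ^ n" for k using y[of w] by (simp_all add: n_y1_y2_def)
    have y2: "a ^ n \<le> y2 $ k" "y2 $ k \<le> b ^ n" for k using y[of w'] w(1) by (simp_all add: n_y1_y2_def)
    have an: "a ^ n > 0" using a by simp
    have q: "y1 $ q > 0" "y2 $ q > 0" "y2 $ p > 0" using an y1 y2 less_le_trans by blast+
    define \<Delta> where "\<Delta> = norm (y1 - y2)"
    have \<Delta>: "\<bar>y1 $ k - y2 $ k\<bar> \<le> \<Delta>" for k
      using component_le_norm_cart[of "y1 - y2" k] by (simp add: \<Delta>_def)
    have "y1 $ p / y1 $ q - y2 $ p / y2 $ q
        = ((y1 $ p - y2 $ p) * y2 $ q - y2 $ p * (y1 $ q - y2 $ q)) / (y1 $ q * y2 $ q)"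
      using q by (simp add: field_simps)
    then have "c ^ n \<le> \<bar>(y1 $ p - y2 $ p) * y2 $ q - y2 $ p * (y1 $ q - y2 $ q)\<bar> / (y1 $ q * y2 $ q)"
      using sep[OF w] q by (simp add: n_y1_y2_def abs_mult)
    also have "\<dots> \<le> (2 * b ^ n * \<Delta>) / (y1 $ q * y2 $ q)"
    proof (rule divide_right_mono)
      have "\<bar>(y1 $ p - y2 $ p) * y2 $ q - y2 $ p * (y1 $ q - y2 $ q)\<bar>
          \<le> \<bar>y1 $ p - y2 $ p\<bar> * y2 $ q + y2 $ p * \<bar>y1 $ q - y2 $ q\<bar>"
        using q by (intro order_trans[OF abs_triangle_ineq4]) (simp add: abs_mult)
      also have "\<dots> \<le> \<Delta> * b ^ n + b ^ n * \<Delta>"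
        using \<Delta> y2 q b by (intro add_mono mult_mono) (auto simp: \<Delta>_def)
      finally show "\<bar>(y1 $ p - y2 $ p) * y2 $ q - y2 $ p * (y1 $ q - y2 $ q)\<bar> \<le> 2 * b ^ n * \<Delta>"
        by (simp add: mult_ac)
    qed (use q in simp)
    finally have "c ^ n * (y1 $ q * y2 $ q) \<le> 2 * b ^ n * \<Delta>" using q by (simp add: pos_le_divide_eq)
    moreover have "c ^ n * (a ^ n * a ^ n) \<le> c ^ n * (y1 $ q * y2 $ q)"
      using c an y1 y2 q by (intro mult_left_mono mult_mono) auto
    ultimately have "c ^ n * (a ^ n * a ^ n) / b ^ n \<le> 2 * \<Delta>"
      using b by (simp add: pos_divide_le_eq mult_ac)
    moreover have "e ^ n = c ^ n * (a ^ n * a ^ n) / b ^ n"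
      by (simp add: e_def power_divide power_mult_distrib power2_eq_square)
    ultimately show ?thesis by (simp add: n_y1_y2_def \<Delta>_def)
  qed
  define g K where "g = min r e" and "K = max 1 (norm (1 :: real^'n))"
  have g: "g > 0" "g \<le> r" "g \<le> e" using r0 e by (auto simp: g_def)
  have K: "K \<ge> 1" "norm (1 :: real^'n) \<le> K" by (auto simp: K_def)
  show ?thesis unfolding strongly_diophantine_def
  \<comment> \<open>The image of \<open>1\<close> has norm at least g^n / 2, so the operator norm is
    at least g^n / (2K). Distinct words have n at least 1, hence (4K)^n is at least 4K, and the
    spare factor 2 yields the strict inequality.\<close>
  proof (intro exI[of _ "g / (4 * K)"] conjI allI impI)
    show "g / (4 * K) > 0" using g K by simp
    fix n and w1 w2 :: "'m list"
    assume w: "length w1 = n \<and> length w2 = n \<and> w1 \<noteq> w2"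
    then have "w1 \<noteq> w2" "length w1 = length w2" by auto
    from same_length_different[OF this]
    obtain u x v y v' where xy: "x \<noteq> y" "w1 = u @ [x] @ v" "w2 = u @ [y] @ v'" by blast
    define W where "W = word_prod A w1 - word_prod A w2"
    have len: "n = length u + length (x # v)" "length (x # v) = length (y # v')" using w xy by auto
    have "W *v 1 = word_prod A u *v (act (($) A) (x # v) - act (($) A) (y # v'))"
      unfolding W_def xy word_prod_append matrix_vector_mult_diff_rdistrib matrix_vector_mult_diff_distrib
      by (simp add: word_prod_append[symmetric] word_prod_act[symmetric] matrix_vector_mul_assoc del: act_simps)
    then have "r ^ length u * (e ^ length (x # v) / 2) \<le> norm (W *v 1)"
      using order_trans[OF mult_left_mono[OF diff_low[OF len(2)], of "r ^ length u"] word_low] xy(1) r0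
      by (simp del: act_simps)
    moreover have "g ^ length u * (g ^ length (x # v) / 2) \<le> r ^ length u * (e ^ length (x # v) / 2)"
      using g by (intro mult_mono divide_right_mono power_mono) auto
    ultimately have "g ^ n / 2 \<le> norm (W *v 1)" unfolding len(1) power_add by simp
    also have "\<dots> \<le> onorm ((*v) W) * norm (1 :: real^'n)"
      by (intro onorm matrix_vector_mul_bounded_linear)
    also have "\<dots> \<le> onorm ((*v) W) * K"
      using K by (intro mult_left_mono onorm_pos_le matrix_vector_mul_bounded_linear) auto
    finally have W: "g ^ n / (2 * K) \<le> onorm ((*v) W)" using K by (simp add: field_simps)
    have "(g / (4 * K)) ^ n = g ^ n / (4 * K) ^ n" by (rule power_divide)
    also have "\<dots> \<le> g ^ n / (4 * K) ^ 1"
      using g K len by (intro divide_left_mono power_increasing) auto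
    also have "\<dots> < g ^ n / (2 * K)" using g K by (simp add: field_simps)
    finally show "(g / (4 * K)) ^ n < onorm (\<lambda>x. (word_prod A w1 - word_prod A w2) *v x)"
      using W unfolding W_def by linarith
  qed
qed

section \<open>Change of basis and scaling\<close>

definition conj_tuple :: "real^'n^'n \<Rightarrow> real^'n^'n \<Rightarrow> ('n::finite,'m::finite) mtuple \<Rightarrow> ('n,'m) mtuple" where
  "conj_tuple Q P A = (\<chi> i. Q ** (A $ i) ** P)"

lemma word_prod_conj_tuple:
  assumes PQ: "P ** Q = mat 1" and QP: "Q ** P = mat 1"
  shows "word_prod (conj_tuple Q P A) w = Q ** word_prod A w ** P"
proof (induction w)
  case (Cons i w)
  have "word_prod (conj_tuple Q P A) (i # w) = (Q ** (A $ i) ** P) ** (Q ** word_prod A w ** P)"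
    using Cons by (simp add: word_prod_def conj_tuple_def)
  also have "\<dots> = Q ** (A $ i) ** (P ** Q) ** word_prod A w ** P" by (simp add: matrix_mul_assoc)
  finally show ?case by (simp add: PQ word_prod_def matrix_mul_assoc)
qed (simp add: word_prod_def QP)

text \<open>Conjugation multiplies norms of differences by at most a constant \<open>K\<close>, and
  \<open>K\<close> is at most K^n because distinct words have positive length.\<close>

lemma strongly_diophantine_conj_tuple:
  fixes A :: "('n::finite,'m::finite) mtuple"
  assumes PQ: "P ** Q = mat 1" "Q ** P = mat 1" and sd: "strongly_diophantine (conj_tuple Q P A)"
  shows "strongly_diophantine A"
proof -
  obtain c where c: "c > 0" "\<And>w1 w2. length w1 = length w2 \<Longrightarrow> w1 \<noteq> w2 \<Longrightarrow>
      c ^ length w1 < onorm ((*v) (word_prod (conj_tuple Q P A) w1 - word_prod (conj_tuple Q P A) w2))"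
    using sd unfolding strongly_diophantine_def by metis
  define K where "K = max 1 (onorm ((*v) Q) * onorm ((*v) P))"
  have K: "K \<ge> 1" "onorm ((*v) Q) * onorm ((*v) P) \<le> K" by (auto simp: K_def)
  show ?thesis unfolding strongly_diophantine_def
  proof (intro exI[of _ "c / K"] conjI allI impI)
    show "c / K > 0" using c K by simp
    fix n and w1 w2 :: "'m list" assume w: "length w1 = n \<and> length w2 = n \<and> w1 \<noteq> w2"
    then have n: "n \<ge> 1" by (cases n) auto
    define W where "W = word_prod A w1 - word_prod A w2"
    have eq: "word_prod (conj_tuple Q P A) w1 - word_prod (conj_tuple Q P A) w2 = Q ** W ** P"
      unfolding word_prod_conj_tuple[OF PQ] W_def
      by (simp add: matrix_eq matrix_vector_mul_assoc[symmetric] matrix_vector_mult_diff_rdistrib matrix_vector_mult_diff_distrib)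
    have W0: "0 \<le> onorm ((*v) W)" by (intro onorm_pos_le matrix_vector_mul_bounded_linear)
    have "c ^ n < onorm ((*v) (Q ** W ** P))"
      using c(2)[of w1 w2] w by (simp add: eq)
    also have "(*v) (Q ** W ** P) = ((*v) Q \<circ> (*v) W) \<circ> (*v) P"
      by (rule ext) (simp add: matrix_vector_mul_assoc matrix_mul_assoc)
    also have "onorm \<dots> \<le> onorm ((*v) Q) * onorm ((*v) W) * onorm ((*v) P)"
      by (intro order_trans[OF onorm_compose] mult_right_mono onorm_compose onorm_pos_le
          matrix_vector_mul_bounded_linear bounded_linear_compose[unfolded o_def[symmetric]])
    also have "\<dots> \<le> K * onorm ((*v) W)"
      using mult_right_mono[OF K(2) W0] by (simp add: mult_ac)
    finally have *: "c ^ n / K < onorm ((*v) W)" using K by (simp add: field_simps)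
    have "K ^ 1 \<le> K ^ n" using K n by (intro power_increasing) auto
    then have "(c / K) ^ n \<le> c ^ n / K"
      unfolding power_divide using c K by (intro divide_left_mono) auto
    then show "(c / K) ^ n < onorm (\<lambda>x. (word_prod A w1 - word_prod A w2) *v x)"
      using * unfolding W_def by linarith
  qed
qed

text \<open>The bad set in the coordinates given by \<open>P\<close> and its inverse
  \<open>Q\<close>. It is phrased through head separation because that condition is stable under
  scaling the matrices separately.\<close>

definition exceptional :: "'n \<Rightarrow> 'n \<Rightarrow> real^'n^'n \<Rightarrow> real^'n^'n \<Rightarrow> ('n::finite,'m::finite) mtuple set" where
  "exceptional p q Q P = {A. pos_tuple (conj_tuple Q P A) \<and> \<not> head_separated p q (conj_tuple Q P A)}"

lemma exceptional_negligible:
  assumes "P ** Q = mat 1" "Q ** P = mat 1" "p \<noteq> q"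
  shows "negligible (exceptional p q Q P :: ('n::finite,'m::finite) mtuple set)"
proof -
  have lin: "linear (conj_tuple P Q :: ('n,'m) mtuple \<Rightarrow> ('n,'m) mtuple)"
    by (rule linearI)
       (simp_all add: conj_tuple_def vec_eq_iff matrix_matrix_mult_def distrib_left distrib_right sum.distrib
          sum_distrib_left sum_distrib_right mult_ac)
  have inv: "conj_tuple P Q (conj_tuple Q P A) = A" for A :: "('n,'m) mtuple"
  proof -
    have "P ** (Q ** (A $ i) ** P) ** Q = (P ** Q) ** (A $ i) ** (P ** Q)" for i
      by (simp add: matrix_mul_assoc)
    then show ?thesis by (simp add: conj_tuple_def vec_eq_iff assms)
  qed
  have "exceptional p q Q P \<subseteq> conj_tuple P Q ` {A :: ('n,'m) mtuple. pos_tuple A \<and> \<not> head_separated p q A}"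
    unfolding exceptional_def using inv by (metis (mono_tags, lifting) image_eqI mem_Collect_eq subsetI)
  moreover have "negligible (conj_tuple P Q ` {A :: ('n,'m) mtuple. pos_tuple A \<and> \<not> head_separated p q A})"
    by (intro negligible_differentiable_image_negligible linear_imp_differentiable_on lin
        pos_tuple_not_head_separated_negligible assms order_refl)
  ultimately show ?thesis using negligible_subset by blast
qed

lemma strongly_diophantine_off_exceptional:
  assumes PQ: "P ** Q = mat 1" "Q ** P = mat 1" and "\<And>i. invertible (A $ i)"
    and "pos_tuple (conj_tuple Q P A)" "A \<notin> exceptional p q Q P"
  shows "strongly_diophantine A"
proof (rule strongly_diophantine_conj_tuple[OF PQ])
  have "invertible Q" "invertible P" using PQ unfolding invertible_def by blast+
  then have "invertible (conj_tuple Q P A $ i)" for i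
    using assms(3) by (simp add: conj_tuple_def invertible_mult)
  then show "strongly_diophantine (conj_tuple Q P A)"
    using head_separated_imp_strongly_diophantine assms unfolding exceptional_def by blast
qed

text \<open>For an interior point, y - t v_k still lies in the cone for some t > 0. Its k-th
  coordinate in the basis is nonnegative, so that of y is at least t.\<close>

lemma interior_cone_of_pos:
  fixes v :: "'n::finite \<Rightarrow> real^'n"
  assumes QP: "Q ** P = mat 1" and P: "\<And>i. column i P = v i" and y: "y \<in> interior (cone_of v)"
  shows "(Q *v y) $ k > 0"
proof -
  have Pe: "P *v axis k 1 = v k" for k by (simp add: P matrix_vector_mul_component[symmetric] matrix_vector_mult_basis)
  have Qv: "Q *v v k = axis k 1" for k
    by (simp add: Pe[symmetric] matrix_vector_mul_assoc QP)
  have nonneg: "0 \<le> (Q *v z) $ k" if z: "z \<in> cone_of v" for z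
  proof -
    obtain x where x: "z = (\<Sum>i\<in>UNIV. x i *\<^sub>R v i)" "\<And>i. x i \<ge> 0"
      using z unfolding cone_of_def by blast
    have "Q *v z = (\<Sum>i\<in>UNIV. x i *\<^sub>R axis i 1)"
      unfolding x(1) by (simp add: linear_sum[OF matrix_vector_mul_linear] matrix_vector_mult_scaleR Qv)
    then show ?thesis using x(2) by (auto simp: axis_def intro!: sum_nonneg)
  qed
  obtain e where e: "e > 0" "ball y e \<subseteq> cone_of v" using y mem_interior by blast
  define t where "t = e / (2 * (norm (v k) + 1))"
  have n: "norm (v k) + 1 > 0" by (simp add: add_nonneg_pos)
  then have t: "t > 0" using e by (simp add: t_def)
  have "t * norm (v k) \<le> t * (norm (v k) + 1)" using t by simp
  also have "\<dots> = e / 2" 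
  proof -
    have "e / (2 * x) * x = e / 2" if "x > 0" for x using that by simp
    then show ?thesis using n unfolding t_def by blast
  qed
  finally have "y - t *\<^sub>R v k \<in> ball y e" using e t by (simp add: dist_norm)
  then have "0 \<le> (Q *v (y - t *\<^sub>R v k)) $ k" using e nonneg by blast
  also have "Q *v (y - t *\<^sub>R v k) = Q *v y - t *\<^sub>R axis k 1"
    by (simp add: matrix_vector_mult_diff_distrib matrix_vector_mult_scaleR Qv)
  finally show ?thesis using t by simp
qed

text \<open>Column \<open>l\<close> of the conjugated matrix is the coordinate vector of A v_l, and
  v_l is a nonzero element of the cone.\<close>

lemma strictly_preserves_cone_of_conj_pos:
  fixes v :: "'n::finite \<Rightarrow> real^'n"
  assumes QP: "Q ** P = mat 1" and P: "\<And>i. column i P = v i" and A: "strictly_preserves A (cone_of v)"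
  shows "(Q ** A ** P) $ k $ l > 0"
proof -
  have Pe: "P *v axis l 1 = v l" for l by (simp add: P matrix_vector_mult_basis)
  have "v l \<noteq> 0"
  proof
    assume "v l = 0"
    then have "Q *v (P *v axis l 1) = 0" by (simp add: Pe)
    then have "axis l 1 = (0 :: real^'n)" by (simp add: matrix_vector_mul_assoc QP)
    then show False by simp
  qed
  moreover have "v l \<in> cone_of v"
  proof -
    have "v l = (\<Sum>i\<in>UNIV. (if i = l then 1 else 0) *\<^sub>R v i)" by (simp add: if_distrib if_distribR cong: if_cong)
    then show ?thesis unfolding cone_of_def by (intro CollectI exI[of _ "\<lambda>i. if i = l then 1 else 0"]) auto
  qed
  ultimately have "A *v v l \<in> interior (cone_of v)" using A by (auto simp: strictly_preserves_def)
  then have "0 < (Q *v (A *v v l)) $ k" by (rule interior_cone_of_pos[OF QP P])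
  also have "Q *v (A *v v l) = (Q ** A ** P) *v axis l 1"
    by (simp add: Pe[symmetric] matrix_vector_mul_assoc matrix_mul_assoc)
  also have "\<dots> = column l (Q ** A ** P)" by (simp add: matrix_vector_mult_basis)
  finally show ?thesis by (simp add: column_def)
qed

section \<open>Invariance of the exceptional set under separate scaling\<close>

lemma act_scale:
  fixes M :: "'m \<Rightarrow> real^'n::finite^'n"
  shows "act (\<lambda>i. t i *\<^sub>R M i) w = prod_list (map t w) *\<^sub>R act M w"
  by (induction w) (simp_all add: matrix_vector_mult_scaleR scaleR_matrix_vector_assoc[symmetric])

definition scale_tuple :: "real^'m \<Rightarrow> ('n::finite,'m::finite) mtuple \<Rightarrow> ('n,'m) mtuple" where
  "scale_tuple t A = (\<chi> i. (t $ i) *\<^sub>R (A $ i))"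

text \<open>Conjugation commutes with scaling, and scaling multiplies all coordinates of
  \<open>act\<close> for a word by the same positive product, which cancels in the quotient.\<close>

lemma exceptional_scale_tuple:
  fixes A :: "('n::finite,'m::finite) mtuple"
  assumes t: "\<And>i. t $ i > 0" and "A \<in> exceptional p q Q P"
  shows "scale_tuple t A \<in> exceptional p q Q P"
proof -
  have conj: "conj_tuple Q P (scale_tuple t A) = scale_tuple t (conj_tuple Q P A)"
    by (simp add: conj_tuple_def scale_tuple_def vec_eq_iff matrix_scaleR scalar_matrix_assoc matrix_scalar_ac)
  have nz: "prod_list (map (($) t) w) \<noteq> 0" for w using t by (auto simp: prod_list_zero_iff less_imp_neq[THEN not_sym])
  have "act (($) (scale_tuple t B)) w = prod_list (map (($) t) w) *\<^sub>R act (($) B) w" for B :: "('n,'m) mtuple" and w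
  proof -
    have "($) (scale_tuple t B) = (\<lambda>i. t $ i *\<^sub>R B $ i)" by (simp add: scale_tuple_def fun_eq_iff)
    then show ?thesis by (simp only: act_scale)
  qed
  then have "head_separated p q (scale_tuple t B) = head_separated p q B" for B :: "('n,'m) mtuple"
    unfolding head_separated_def using nz by simp
  moreover have "pos_tuple (scale_tuple t B) = pos_tuple B" for B :: "('n,'m) mtuple"
  proof -
    have "0 < t $ i * x \<longleftrightarrow> 0 < x" for i x using t[of i] by (auto simp: zero_less_mult_iff)
    then show ?thesis by (simp add: pos_tuple_def scale_tuple_def)
  qed
  ultimately show ?thesis using assms(2) by (simp add: exceptional_def conj)
qed

section \<open>Unimodular tuples\<close>

text \<open>By Fubini almost every slice of the product is null, whereas the slices over points of
  \<open>S\<close> are \<open>V\<close>, which has positive measure.\<close>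

lemma negligible_Times_open_imp:
  fixes S :: "'a::euclidean_space set" and V :: "'b::euclidean_space set"
  assumes "negligible (S \<times> V)" and V: "open V" "V \<noteq> {}"
  shows "negligible S"
proof -
  have "S \<times> V \<in> null_sets (completion lborel)"
    using assms(1) negligible_iff_null_sets by blast
  \<comment> \<open>\<open>S\<close> need not be measurable, so Fubini is applied to a Borel null
    set containing the product.\<close>
  then obtain T where T: "T \<in> null_sets lborel" "S \<times> V \<subseteq> T"
    by (auto simp: null_sets_completion_iff2)
  have "AE x in lborel \<Otimes>\<^sub>M lborel. x \<notin> T"
    unfolding lborel_prod by (rule AE_not_in[OF T(1)])
  then have "AE u in lborel. AE t in lborel. (u :: 'a, t :: 'b) \<notin> T"
    by (rule lborel_pair.AE_pair)
  then have "AE u in lborel. u \<notin> S"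
  proof eventually_elim
    case (elim u)
    show "u \<notin> S"
    proof
      assume "u \<in> S"
      then have "AE t in lborel. t \<notin> V" using elim T(2) by (auto elim!: eventually_mono)
      then have "emeasure lborel V = 0"
        using V(1) by (subst (asm) AE_iff_measurable[of V]) auto
      then have "V \<in> null_sets lborel" using V(1) by auto
      then have "negligible V" by (simp add: negligible_iff_null_sets null_sets_completionI)
      then show False using V open_not_negligible by blast
    qed
  qed
  then obtain N where N: "{u. u \<in> S} \<subseteq> N" "N \<in> null_sets lborel"
    by (auto simp: eventually_ae_filter)
  then have "negligible N" by (simp add: negligible_iff_null_sets null_sets_completionI)
  then show ?thesis using N(1) negligible_subset by auto
qed

lemma negligible_linear_image_eq_dim:
  fixes L :: "'a::euclidean_space \<Rightarrow> 'b::euclidean_space"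
  assumes "linear L" "DIM('a) = DIM('b)" "negligible N"
  shows "negligible (L ` N)"
  using assms by (intro negligible_differentiable_image_negligible linear_imp_differentiable_on) auto

text \<open>A linear isomorphism \<open>L\<close> of the target onto the source turns
  \<open>f\<close> into a map from a space to itself with injective derivative, to which
  \<open>negligible_differentiable_vimage\<close> applies.\<close>

lemma negligible_vimage_immersion:
  fixes f :: "'a::euclidean_space \<Rightarrow> 'b::euclidean_space"
  assumes dim: "DIM('a) = DIM('b)" and N: "negligible N"
    and f: "\<And>x. x \<in> W \<Longrightarrow> (f has_derivative f' x) (at x within W)" "\<And>x. x \<in> W \<Longrightarrow> inj (f' x)"
  shows "negligible {x \<in> W. f x \<in> N}"
proof -
  obtain L :: "'b \<Rightarrow> 'a" and M :: "'a \<Rightarrow> 'b" where L: "linear L" "\<And>x. M (L x) = x"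
    using isomorphisms_UNIV_UNIV[OF dim[symmetric]] by metis
  have injL: "inj L" using L(2) by (metis injI)
  have "negligible {x \<in> W. (L \<circ> f) x \<in> L ` N}"
  proof (rule negligible_differentiable_vimage)
    show "negligible (L ` N)" using L(1) N dim by (intro negligible_linear_image_eq_dim) auto
    fix x assume x: "x \<in> W"
    show "inj (L \<circ> f' x)" using injL f(2)[OF x] by (rule inj_compose)
    show "(L \<circ> f has_derivative L \<circ> f' x) (at x within W)"
      using f(1)[OF x] L(1) by (intro diff_chain_within linear_imp_has_derivative)
  qed
  then show ?thesis by (rule negligible_subset) auto
qed

section \<open>The determinant along rays and the scaled immersion\<close>

lemma det_differentiable: "\<exists>d. (det has_derivative d) (at (X :: real^'n::finite^'n))"
proof -
  have der: "((\<lambda>A :: real^'n^'n. A $ i $ j) has_derivative (\<lambda>A. A $ i $ j)) (at X)" for i j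
    by (intro linear_imp_has_derivative linearI) auto
  have "(\<lambda>A :: real^'n^'n. \<Prod>i\<in>UNIV. A $ i $ \<pi> i) differentiable (at X)" for \<pi>
    by (rule differentiableI[OF has_derivative_prod[OF der]])
  then have "(\<lambda>A :: real^'n^'n. of_int (sign \<pi>) * (\<Prod>i\<in>UNIV. A $ i $ \<pi> i)) differentiable (at X)" for \<pi>
    by (rule differentiable_mult[OF differentiable_const])
  then have "(\<lambda>A :: real^'n^'n. det A) differentiable (at X)"
    unfolding det_def by (rule_tac differentiable_sum) (simp_all add: finite_permutations)
  then show ?thesis by (simp add: differentiable_def)
qed

lemma det_scaleR: "det (c *\<^sub>R X) = c ^ CARD('n) * det (X :: real^'n::finite^'n)"
  by (simp add: det_def prod.distrib sum_distrib_left mult_ac)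

text \<open>Euler's identity: differentiate det (c X) = c^d at c = 1, where d is the
  dimension.\<close>

lemma det_derivative_radial:
  fixes X :: "real^'n::finite^'n"
  assumes "(det has_derivative d) (at X)" "det X = 1"
  shows "d X = CARD('n)"
proof -
  have "((\<lambda>c :: real. det (c *\<^sub>R X)) has_derivative (\<lambda>h. d (h *\<^sub>R X))) (at 1)"
    using diff_chain_at[of "\<lambda>c :: real. c *\<^sub>R X" "\<lambda>h. h *\<^sub>R X" 1 det d] assms(1)
    by (simp add: o_def has_derivative_scaleR_left has_derivative_ident)
  moreover have "((\<lambda>c :: real. c ^ CARD('n)) has_derivative (\<lambda>h :: real. h * (real CARD('n) * 1 ^ (CARD('n) - 1)))) (at 1)"
    using DERIV_pow[of "CARD('n)" "1 :: real"] by (simp add: has_field_derivative_def mult.commute[of _ "real _"])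
  moreover have "(\<lambda>c :: real. det (c *\<^sub>R X)) = (\<lambda>c. c ^ CARD('n))"
    by (simp add: det_scaleR assms(2))
  ultimately have "(\<lambda>h :: real. d (h *\<^sub>R X)) = (\<lambda>h :: real. h * (real CARD('n) * 1 ^ (CARD('n) - 1)))"
    by (simp only: has_derivative_unique)
  from fun_cong[OF this, of 1] show ?thesis by simp
qed

lemma bounded_bilinear_scale_tuple:
  "bounded_bilinear (scale_tuple :: real^'m \<Rightarrow> ('n::finite,'m::finite) mtuple \<Rightarrow> ('n,'m) mtuple)"
  unfolding bilinear_conv_bounded_bilinear[symmetric] bilinear_def
  by (auto intro!: linearI simp: scale_tuple_def vec_eq_iff algebra_simps)

text \<open>The map \<open>\<Phi>\<close>, sending (u, t) to the tuple of \<open>\<phi>\<close> at u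
  scaled by t, goes between spaces of equal dimension and has injective derivative, so it pulls
  \<open>N\<close> back to a null set. As \<open>N\<close> is invariant under scaling, this preimage
  contains the product of the wanted set with the open set \<open>V\<close> of positive scalings,
  and \<open>negligible_Times_open_imp\<close> concludes.\<close>

lemma scaling_invariant_null_vimage:
  fixes \<phi> :: "'k::euclidean_space \<Rightarrow> ('n::finite,'m::finite) mtuple"
  assumes dimk: "DIM('k) = (CARD('n)^2 - 1) * CARD('m)"
    and U: "open U" "c1_immersion_on U \<phi>" "\<And>u i. u \<in> U \<Longrightarrow> det (\<phi> u $ i) = 1"
    and N: "negligible N" "\<And>A t. A \<in> N \<Longrightarrow> (\<And>i. t $ i > 0) \<Longrightarrow> scale_tuple t A \<in> N"
  shows "negligible {u \<in> U. \<phi> u \<in> N}"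
proof -
  obtain \<phi>' where \<phi>': "\<And>u. u \<in> U \<Longrightarrow> (\<phi> has_derivative blinfun_apply (\<phi>' u)) (at u)"
    "\<And>u. u \<in> U \<Longrightarrow> inj (blinfun_apply (\<phi>' u))"
    using U(2) unfolding c1_immersion_on_def by blast
  define V where "V = {t :: real^'m. \<forall>i. t $ i > 0}"
  have "open V"
  proof -
    have "open {t :: real^'m. 0 < t $ i}" for i
      by (intro open_Collect_less continuous_on_const continuous_on_component continuous_on_id)
    then have "open (\<Inter>i. {t :: real^'m. 0 < t $ i})" by (intro open_INT) auto
    moreover have "V = (\<Inter>i. {t. t $ i > 0})" by (auto simp: V_def)
    ultimately show ?thesis by simp
  qed
  have "1 \<in> V" by (simp add: V_def)
  define \<Phi> where "\<Phi> = (\<lambda>x :: 'k \<times> (real^'m). scale_tuple (snd x) (\<phi> (fst x)))"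
  define \<Phi>' where "\<Phi>' = (\<lambda>x h :: 'k \<times> (real^'m). scale_tuple (snd x) (\<phi>' (fst x) (fst h)) + scale_tuple (snd h) (\<phi> (fst x)))"
  have der: "(\<Phi> has_derivative \<Phi>' x) (at x within U \<times> V)" if x: "x \<in> U \<times> V" for x
  proof -
    have "((\<lambda>x. \<phi> (fst x)) has_derivative (\<lambda>h. \<phi>' (fst x) (fst h))) (at x within U \<times> V)"
      using x by (intro has_derivative_compose[OF has_derivative_fst[OF has_derivative_ident] \<phi>'(1)]) auto
    then show ?thesis unfolding \<Phi>_def \<Phi>'_def
      by (rule bounded_bilinear.FDERIV[OF bounded_bilinear_scale_tuple has_derivative_snd[OF has_derivative_ident]])
  qed
  have inj: "inj (\<Phi>' x)" if x: "x \<in> U \<times> V" for x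
  proof -
    obtain u t where ut: "x = (u, t)" "u \<in> U" "t \<in> V" using x by auto
    have "linear (\<Phi>' x)" using der[OF x] has_derivative_linear by blast
    moreover have "h = 0" if h: "\<Phi>' x h = 0" for h
    proof -
      obtain k s where ks: "h = (k, s)" by (cases h)
      have rel: "t $ i *\<^sub>R (\<phi>' u k $ i) + s $ i *\<^sub>R (\<phi> u $ i) = 0" for i
        using h unfolding \<Phi>'_def ut(1) ks by (simp add: scale_tuple_def vec_eq_iff)
      \<comment> \<open>The derivative of the determinant is applied to \<open>rel\<close>. It kills
        the first summand, since the determinant is constant along \<open>\<phi>\<close>, and sends
        the second, radial one to \<open>s $ i\<close> times the dimension.\<close>
      have s0: "s $ i = 0" for i
      proof -
        obtain d where d: "(det has_derivative d) (at (\<phi> u $ i))" using det_differentiable by blast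
        have "((\<lambda>u. \<phi> u $ i) has_derivative (\<lambda>h. \<phi>' u h $ i)) (at u)"
          by (rule bounded_linear.has_derivative[OF bounded_linear_vec_nth \<phi>'(1)[OF ut(2)]])
        from diff_chain_at[OF this d]
        have "((\<lambda>u. det (\<phi> u $ i)) has_derivative (\<lambda>h. d (\<phi>' u h $ i))) (at u)" by (simp add: o_def)
        moreover have "((\<lambda>u. det (\<phi> u $ i)) has_derivative (\<lambda>h. 0)) (at u)"
          by (rule has_derivative_transform_within_open[OF has_derivative_const[of 1] U(1) ut(2)])
             (simp add: U(3))
        ultimately have "(\<lambda>h. d (\<phi>' u h $ i)) = (\<lambda>h. 0)" by (rule has_derivative_unique)
        then have d0: "d (\<phi>' u k $ i) = 0" by (rule fun_cong)
        have lin: "linear d" using d has_derivative_linear by blast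
        have "0 = d (t $ i *\<^sub>R (\<phi>' u k $ i) + s $ i *\<^sub>R (\<phi> u $ i))"
          using rel linear_0[OF lin] by simp
        also have "\<dots> = s $ i * CARD('n)"
          using det_derivative_radial[OF d U(3)[OF ut(2)]] d0
          by (simp add: linear_add[OF lin] linear_cmul[OF lin])
        finally show ?thesis by simp
      qed
      have "\<phi>' u k $ i = 0" for i
        using rel[of i] s0[of i] ut(3) by (auto simp: V_def less_le)
      then have "\<phi>' u k = \<phi>' u 0" by (simp add: vec_eq_iff blinfun.zero_right)
      then have "k = 0" using \<phi>'(2)[OF ut(2)] by (meson injD)
      moreover have "s = 0" using s0 by (simp add: vec_eq_iff)
      ultimately show "h = 0" by (simp add: ks zero_prod_def)
    qed
    ultimately show ?thesis by (simp add: linear_injective_0)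
  qed
  \<comment> \<open>The subtraction in \<open>dimk\<close> is on naturals, so this is needed to
    obtain (d^2 - 1) m + m = d^2 m.\<close>
  have "1 \<le> CARD('n)^2" by (simp add: Suc_le_eq)
  then have "(CARD('n)^2 - 1) * CARD('m) + CARD('m) = CARD('m) * (CARD('n) * CARD('n))"
    by (cases "CARD('n)^2") (auto simp: power2_eq_square mult_ac)
  then have dim: "DIM('k \<times> (real^'m)) = DIM(('n,'m) mtuple)"
    by (simp add: dimk)
  have "negligible {x \<in> U \<times> V. \<Phi> x \<in> N}"
    by (rule negligible_vimage_immersion[OF dim N(1) der inj])
  moreover have "{u \<in> U. \<phi> u \<in> N} \<times> V \<subseteq> {x \<in> U \<times> V. \<Phi> x \<in> N}"
    by (auto simp: \<Phi>_def V_def intro: N(2))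
  ultimately have "negligible ({u \<in> U. \<phi> u \<in> N} \<times> V)" by (rule negligible_subset)
  moreover have "V \<noteq> {}" using \<open>1 \<in> V\<close> by blast
  ultimately show ?thesis using \<open>open V\<close> negligible_Times_open_imp by blast
qed

section \<open>Assembling the statements for GL and SL\<close>

lemma smooth_null_not_strongly_diophantine:
  fixes M :: "('n::finite,'m::finite) mtuple set"
  assumes dimk: "DIM('k::euclidean_space) = (CARD('n)^2 - 1) * CARD('m)"
    and PQ: "P ** Q = mat 1" "Q ** P = mat 1" "(p :: 'n) \<noteq> q"
    and M: "\<And>A i. A \<in> M \<Longrightarrow> det (A $ i) = 1" "\<And>A. A \<in> M \<Longrightarrow> pos_tuple (conj_tuple Q P A)"
  shows "smooth_null TYPE('k) M {A \<in> M. \<not> strongly_diophantine A}"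
  unfolding smooth_null_def
proof (intro allI impI)
  fix U :: "'k set" and \<phi> assume U: "open U \<and> c1_immersion_on U \<phi> \<and> \<phi> ` U \<subseteq> M"
  have "negligible {u \<in> U. \<phi> u \<in> exceptional p q Q P}"
    using U M(1) by (intro scaling_invariant_null_vimage[OF dimk] exceptional_negligible[OF PQ] exceptional_scale_tuple) auto
  moreover have "{u \<in> U. \<phi> u \<in> {A \<in> M. \<not> strongly_diophantine A}} \<subseteq> {u \<in> U. \<phi> u \<in> exceptional p q Q P}"
  proof safe
    fix u assume u: "\<phi> u \<in> M" "\<not> strongly_diophantine (\<phi> u)"
    have inv: "invertible (\<phi> u $ i)" for i using M(1)[OF u(1), of i] by (simp add: invertible_det_nz)
    then show "\<phi> u \<in> exceptional p q Q P"
      using strongly_diophantine_off_exceptional[OF PQ(1,2) inv M(2)[OF u(1)]] u(2) by blast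
  qed
  ultimately show "{u \<in> U. \<phi> u \<in> {A \<in> M. \<not> strongly_diophantine A}} \<in> null_sets lebesgue"
    unfolding negligible_iff_null_sets[symmetric] by (rule negligible_subset)
qed

text \<open>Like \<open>smooth_null_not_strongly_diophantine\<close>, this is stated for a general
  \<open>M\<close>, to serve both the cone-preserving tuples and, with \<open>P\<close> and
  \<open>Q\<close> the identity, the entrywise positive ones.\<close>

lemma AE_strongly_diophantine:
  assumes PQ: "P ** Q = mat 1" "Q ** P = mat 1" "(p :: 'n::finite) \<noteq> q"
    and M: "\<And>A i. A \<in> M \<Longrightarrow> invertible (A $ i)" "\<And>A. A \<in> M \<Longrightarrow> pos_tuple (conj_tuple Q P A)"
  shows "AE A :: ('n::finite,'m::finite) mtuple in lebesgue. A \<in> M \<longrightarrow> strongly_diophantine A"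
proof -
  have "exceptional p q Q P \<in> null_sets (lebesgue :: ('n,'m) mtuple measure)"
    using exceptional_negligible[OF PQ] negligible_iff_null_sets by blast
  then show ?thesis
  proof (rule AE_I', intro subsetI)
    fix A :: "('n,'m) mtuple" assume "A \<in> {A \<in> space lebesgue. \<not> (A \<in> M \<longrightarrow> strongly_diophantine A)}"
    then have A: "A \<in> M" "\<not> strongly_diophantine A" by simp_all
    show "A \<in> exceptional p q Q P"
      using strongly_diophantine_off_exceptional[OF PQ(1,2) M(1)[OF A(1)] M(2)[OF A(1)]] A(2) by blast
  qed
qed

lemma basis_matrix_inverse:
  fixes v :: "'n::finite \<Rightarrow> real^'n"
  assumes "inj v" "independent (range v)"
  obtains P Q where "P ** Q = mat 1" "Q ** P = mat 1" "\<And>i. column i P = v i"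
proof -
  define P :: "real^'n^'n" where "P = (\<chi> i j. v j $ i)"
  have P: "column i P = v i" for i by (simp add: P_def column_def)
  have "\<exists>Q. Q ** P = mat 1"
    unfolding matrix_left_invertible_independent_columns
  proof (intro allI impI)
    fix c i assume "(\<Sum>i\<in>UNIV. c i *s column i P) = 0"
    then have "(\<Sum>x\<in>range v. c (inv v x) *\<^sub>R x) = 0"
      using \<open>inj v\<close> by (simp add: sum.reindex P scalar_mult_eq_scaleR)
    then have "c (inv v (v i)) = 0"
      using independentD[OF assms(2), of "range v" "\<lambda>x. c (inv v x)" "v i"] by simp
    then show "c i = 0" using \<open>inj v\<close> by simp
  qed
  then obtain Q where Q: "Q ** P = mat 1" ..
  then have "P ** Q = mat 1" using matrix_left_right_inverse by blast
  then show ?thesis using that Q P by blast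
qed

lemma cone_preserving_conj_pos:
  assumes "Q ** P = mat 1" "\<And>i. column i P = v i" "A \<in> X_set (cone_of v) \<union> Y_set (cone_of v)"
  shows "pos_tuple (conj_tuple Q P A)"
  using strictly_preserves_cone_of_conj_pos[OF assms(1,2)] assms(3)
  by (auto simp: pos_tuple_def conj_tuple_def X_set_def Y_set_def)

theorem theorem1p2:
  fixes v :: "'n::finite \<Rightarrow> real^'n"
  assumes d2: "CARD('n) \<ge> 2"
    and m2: "CARD('m::finite) \<ge> 2"
    and indep: "inj v" "independent (range v)"
    and dimk: "DIM('k::euclidean_space) = (CARD('n)^2 - 1) * CARD('m)"
  shows "(AE A in lebesgue. A \<in> (X_set (cone_of v) :: ('n,'m) mtuple set)
              \<longrightarrow> strongly_diophantine A)
       \<and> (AE A in lebesgue. ((\<forall>i. invertible (A$i) \<and> (\<forall>j k. A$i$j$k > 0))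
              \<longrightarrow> strongly_diophantine (A :: ('n,'m) mtuple)))
       \<and> smooth_null TYPE('k) (Y_set (cone_of v) :: ('n,'m) mtuple set)
              {A \<in> Y_set (cone_of v). \<not> strongly_diophantine A}
       \<and> smooth_null TYPE('k) {A :: ('n,'m) mtuple. \<forall>i. det (A$i) = 1 \<and> (\<forall>j k. A$i$j$k > 0)}
              {A. (\<forall>i. det (A$i) = 1 \<and> (\<forall>j k. A$i$j$k > 0)) \<and> \<not> strongly_diophantine A}"
proof -
  have "\<not> is_singleton (UNIV :: 'n set)"
    using d2 by (simp add: is_singleton_altdef)
  then obtain p q :: 'n where pq: "p \<noteq> q"
    by (meson UNIV_I UNIV_not_empty is_singletonI')
  obtain P Q where PQ: "P ** Q = mat 1" "Q ** P = mat 1" and P: "\<And>i. column i P = v i"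
    by (rule basis_matrix_inverse[OF indep, of thesis]) (rule that)
  have id: "mat 1 ** mat 1 = (mat 1 :: real^'n^'n)" by simp
  define Pos where "Pos = {A :: ('n,'m) mtuple. \<forall>i. invertible (A$i) \<and> (\<forall>j k. A$i$j$k > 0)}"
  define PosS where "PosS = {A :: ('n,'m) mtuple. \<forall>i. det (A$i) = 1 \<and> (\<forall>j k. A$i$j$k > 0)}"
  have "AE A in lebesgue. A \<in> (X_set (cone_of v) :: ('n,'m) mtuple set) \<longrightarrow> strongly_diophantine A"
    by (rule AE_strongly_diophantine[OF PQ pq]) (use cone_preserving_conj_pos[OF PQ(2) P] in \<open>auto simp: X_set_def\<close>)
  moreover have "AE A in lebesgue. A \<in> Pos \<longrightarrow> strongly_diophantine A"
    by (rule AE_strongly_diophantine[OF id id pq]) (auto simp: Pos_def pos_tuple_def conj_tuple_def)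
  moreover have "smooth_null TYPE('k) (Y_set (cone_of v) :: ('n,'m) mtuple set)
              {A \<in> Y_set (cone_of v). \<not> strongly_diophantine A}"
    by (rule smooth_null_not_strongly_diophantine[OF dimk PQ pq])
       (use cone_preserving_conj_pos[OF PQ(2) P] in \<open>auto simp: Y_set_def\<close>)
  moreover have "smooth_null TYPE('k) PosS {A \<in> PosS. \<not> strongly_diophantine A}"
    by (rule smooth_null_not_strongly_diophantine[OF dimk id id pq])
       (auto simp: PosS_def pos_tuple_def conj_tuple_def)
  ultimately show ?thesis by (simp add: Pos_def PosS_def)
qed

end
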